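(* If $G$ is a $2K_2$-free unit interval graph, then its chromatic symmetric function $X_G$ is $e$-positive.
   Context: All graphs are finite and simple. A unit interval graph is a graph whose vertices can be represented by intervals of unit length on the real line, so that two distinct vertices are adjacent if and only if their intervals intersect. $2K_2$ is the graph on four vertices consisting of two disjoint edges; a graph is $2K_2$-free if it has no induced subgraph isomorphic to $2K_2$. For a graph $G=(V,E)$, a proper coloring is a function $\kappa:V\to\{1,2,3,\ldots\}$ with $\kappa(u)\ne\kappa(v)$ whenever $uv\in E$. The chromatic symmetric function of $G$ is $X_G=\sum_{\kappa}\prod_{v\in V}x_{\kappa(v)}$, the sum over all proper colorings $\kappa$ of $G$; it is a homogeneous symmetric function of degree $|V|$ in the variables $x_1,x_2,\ldots$. The elementary symmetric functions are $e_0=1$, $e_i=\sum_{1\le j_1<\cdots<j_i}x_{j_1}\cdots x_{j_i}$ for $i\ge1$, and $e_\lambda=e_{\lambda_1}e_{\lambda_2}\cdots e_{\lambda_k}$ for an integer partition $\lambda=(\lambda_1,\ldots,\lambda_k)$; the set $\{e_\lambda:\lambda\vdash n\}$ is a basis of the homogeneous symmetric functions of degree $n$. $X_G$ is called $e$-positive if it is a nonnegative linear combination of the $e_\lambda$. *)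

theory Defs
  imports Complex_Main "HOL-Library.Poly_Mapping" "HOL-Library.FuncSet" "HOL-Library.Multiset"
begin

section \<open>Finite simple graphs\<close>

definition simple_graph :: "'a set \<Rightarrow> 'a set set \<Rightarrow> bool" where
  "simple_graph V E \<longleftrightarrow> finite V \<and> (\<forall>e\<in>E. e \<subseteq> V \<and> card e = 2)"

definition induced_edges :: "'a set set \<Rightarrow> 'a set \<Rightarrow> 'a set set" where
  "induced_edges E W = {e \<in> E. e \<subseteq> W}"

definition graph_isomorphic :: "'a set \<Rightarrow> 'a set set \<Rightarrow> 'b set \<Rightarrow> 'b set set \<Rightarrow> bool" where
  "graph_isomorphic V E V' E' \<longleftrightarrow>
     (\<exists>\<phi>. bij_betw \<phi> V V' \<and> (\<forall>u\<in>V. \<forall>v\<in>V. {u, v} \<in> E \<longleftrightarrow> {\<phi> u, \<phi> v} \<in> E'))"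

definition twoK2_verts :: "nat set" where
  "twoK2_verts = {0, 1, 2, 3}"

definition twoK2_edges :: "nat set set" where
  "twoK2_edges = {{0, 1}, {2, 3}}"

definition twoK2_free :: "'a set \<Rightarrow> 'a set set \<Rightarrow> bool" where
  "twoK2_free V E \<longleftrightarrow>
     \<not> (\<exists>W\<subseteq>V. graph_isomorphic W (induced_edges E W) twoK2_verts twoK2_edges)"

text \<open>Intervals are closed. Distinct vertices may be represented by the same interval; they are
  then adjacent.\<close>

definition unit_interval_graph :: "'a set \<Rightarrow> 'a set set \<Rightarrow> bool" where
  "unit_interval_graph V E \<longleftrightarrow> simple_graph V E \<and>
     (\<exists>l :: 'a \<Rightarrow> real. \<forall>u\<in>V. \<forall>v\<in>V. u \<noteq> v \<longrightarrow>
        ({u, v} \<in> E \<longleftrightarrow> {l u .. l u + 1} \<inter> {l v .. l v + 1} \<noteq> {}))"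

definition proper_colorings :: "'a set \<Rightarrow> 'a set set \<Rightarrow> ('a \<Rightarrow> nat) set" where
  "proper_colorings V E =
     {\<kappa> \<in> V \<rightarrow>\<^sub>E {1..}. \<forall>u\<in>V. \<forall>v\<in>V. {u, v} \<in> E \<longrightarrow> \<kappa> u \<noteq> \<kappa> v}"


section \<open>Formal power series in infinitely many variables\<close>

text \<open>A monomial is its finitely supported exponent vector, so the variable \<open>x\<^sub>j\<close> is
  \<open>Poly_Mapping.single j 1\<close> and products of monomials are sums of exponent vectors.\<close>

type_synonym monomial = "nat \<Rightarrow>\<^sub>0 nat"

typedef power_series = "UNIV :: (monomial \<Rightarrow> real) set"
  morphisms coeff Power_Series by simp

setup_lifting type_definition_power_series

lemma power_series_eqI: "(\<And>m. coeff f m = coeff g m) \<Longrightarrow> f = g"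
  by transfer auto

definition splits :: "monomial \<Rightarrow> (monomial \<times> monomial) set" where
  "splits m = {(a, b). a + b = m}"

lemma finite_below_monomial:
  fixes m :: monomial
  shows "finite {a. \<forall>i. Poly_Mapping.lookup a i \<le> Poly_Mapping.lookup m i}"
proof -
  let ?A = "{a :: monomial. \<forall>i. Poly_Mapping.lookup a i \<le> Poly_Mapping.lookup m i}"
  let ?r = "\<lambda>a :: monomial. restrict (Poly_Mapping.lookup a) (Poly_Mapping.keys m)"
  have "?r ` ?A \<subseteq> (\<Pi>\<^sub>E i\<in>Poly_Mapping.keys m. {..Poly_Mapping.lookup m i})"
    by auto
  moreover have "finite (\<Pi>\<^sub>E i\<in>Poly_Mapping.keys m. {..Poly_Mapping.lookup m i})"
    by (intro finite_PiE) auto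
  moreover have "inj_on ?r ?A"
  proof (rule inj_onI, rule poly_mapping_eqI)
    fix a b i assume ab: "a \<in> ?A" "b \<in> ?A" "?r a = ?r b"
    show "Poly_Mapping.lookup a i = Poly_Mapping.lookup b i"
    proof (cases "i \<in> Poly_Mapping.keys m")
      case True
      then show ?thesis using fun_cong[OF ab(3), of i] by simp
    next
      case False
      then have "Poly_Mapping.lookup m i = 0" by (simp add: in_keys_iff)
      then show ?thesis using ab(1,2) by (metis (mono_tags) le_zero_eq mem_Collect_eq)
    qed
  qed
  ultimately show ?thesis
    by (meson finite_imageD finite_subset)
qed

lemma finite_splits: "finite (splits m)"
proof -
  let ?B = "{a. \<forall>i. Poly_Mapping.lookup a i \<le> Poly_Mapping.lookup m i}"
  have "splits m \<subseteq> ?B \<times> ?B"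
    by (auto simp: splits_def lookup_add)
  then show ?thesis
    using finite_below_monomial finite_subset by blast
qed

instantiation power_series :: "{comm_ring_1, real_algebra_1}"
begin

lift_definition zero_power_series :: power_series is "\<lambda>_. 0" .
lift_definition one_power_series :: power_series is "\<lambda>m. if m = 0 then 1 else 0" .
lift_definition plus_power_series :: "power_series \<Rightarrow> power_series \<Rightarrow> power_series"
  is "\<lambda>f g m. f m + g m" .
lift_definition minus_power_series :: "power_series \<Rightarrow> power_series \<Rightarrow> power_series"
  is "\<lambda>f g m. f m - g m" .
lift_definition uminus_power_series :: "power_series \<Rightarrow> power_series"
  is "\<lambda>f m. - f m" .
lift_definition scaleR_power_series :: "real \<Rightarrow> power_series \<Rightarrow> power_series"
  is "\<lambda>r f m. r * f m" .
lift_definition times_power_series :: "power_series \<Rightarrow> power_series \<Rightarrow> power_series"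
  is "\<lambda>f g m. \<Sum>(a, b)\<in>splits m. f a * g b" .

instance
proof
  fix f g h :: power_series and r s :: real
  show "f * g * h = f * (g * h)"
  proof (rule power_series_eqI)
    fix m
    have "coeff (f * g * h) m =
        (\<Sum>(x, c)\<in>splits m. \<Sum>(a, b)\<in>splits x. coeff f a * coeff g b * coeff h c)"
      by transfer (simp add: sum_distrib_right case_prod_unfold)
    also have "\<dots> = (\<Sum>(p, q)\<in>(SIGMA p:splits m. splits (fst p)).
        coeff f (fst q) * coeff g (snd q) * coeff h (snd p))"
      by (subst sum.Sigma[symmetric]) (auto simp: finite_splits case_prod_unfold)
    also have "\<dots> = (\<Sum>(p, q)\<in>(SIGMA p:splits m. splits (snd p)).
        coeff f (fst p) * (coeff g (fst q) * coeff h (snd q)))"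
      by (rule sum.reindex_bij_witness[of _
            "\<lambda>((a, _), (b, c)). ((a + b, c), (a, b))" "\<lambda>((_, c), (a, b)). ((a, b + c), (b, c))"])
         (auto simp: splits_def ac_simps)
    also have "\<dots> = (\<Sum>(a, x)\<in>splits m. \<Sum>(b, c)\<in>splits x. coeff f a * (coeff g b * coeff h c))"
      by (subst sum.Sigma[symmetric]) (auto simp: finite_splits case_prod_unfold)
    also have "\<dots> = coeff (f * (g * h)) m"
      by transfer (simp add: sum_distrib_left case_prod_unfold)
    finally show "coeff (f * g * h) m = coeff (f * (g * h)) m" .
  qed
  show comm: "f * g = g * f" for f g :: power_series
  proof (rule power_series_eqI)
    fix m
    show "coeff (f * g) m = coeff (g * f) m"
      unfolding times_power_series.rep_eq
      by (rule sum.reindex_bij_witness[of _ prod.swap prod.swap])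
         (auto simp: splits_def ac_simps)
  qed
  show one_left: "1 * f = f"
  proof (rule power_series_eqI)
    fix m
    have "coeff (1 * f) m = (\<Sum>(a, b)\<in>splits m. (if a = 0 then 1 else 0) * coeff f b)"
      by transfer simp
    also have "\<dots> = (\<Sum>(a, b)\<in>{(0 :: monomial, m)}. (if a = 0 then 1 else 0) * coeff f b)"
      proof (rule sum.mono_neutral_right)
      show "finite (splits m)" by (rule finite_splits)
      show "{(0, m)} \<subseteq> splits m" by (simp add: splits_def)
      show "\<forall>i\<in>splits m - {(0, m)}. (case i of (a, b) \<Rightarrow> (if a = 0 then 1 else 0) * coeff f b) = 0"
        unfolding splits_def by (rule ballI) (simp split: prod.splits, metis add_0)
    qed
    finally show "coeff (1 * f) m = coeff f m" by simp
  qed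
  show "f * 1 = f"
    using one_left by (simp add: comm[of f 1])
  show distrib: "(f + g) * h = f * h + g * h" for f g h :: power_series
    by transfer (auto simp: algebra_simps sum.distrib case_prod_unfold)
  show "f * (g + h) = f * g + f * h"
    using distrib[of g h f] by (simp add: comm[of f])
  show "r *\<^sub>R f * g = r *\<^sub>R (f * g)"
    by transfer (auto simp: sum_distrib_left algebra_simps case_prod_unfold)
  show "f * r *\<^sub>R g = r *\<^sub>R (f * g)"
    by transfer (auto simp: sum_distrib_left algebra_simps case_prod_unfold)
  show "(0 :: power_series) \<noteq> 1"
  proof
    assume "(0 :: power_series) = 1"
    then have "coeff 0 0 = coeff 1 0" by simp
    then show False by (simp add: zero_power_series.rep_eq one_power_series.rep_eq)
  qed
qed (rule power_series_eqI,
  simp add: zero_power_series.rep_eq plus_power_series.rep_eq minus_power_series.rep_eq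
    uminus_power_series.rep_eq scaleR_power_series.rep_eq algebra_simps)+

end

text \<open>The formal sum \<open>\<Sum>\<^sub>a\<^sub>\<in>\<^sub>A x\<^sup>w\<^sup>(\<^sup>a\<^sup>)\<close>, where \<open>A\<close> may be infinite. It is meaningful when each monomial
  arises from only finitely many \<open>a \<in> A\<close>, since \<open>card\<close> is zero on infinite sets.\<close>

definition monomial_sum :: "'b set \<Rightarrow> ('b \<Rightarrow> monomial) \<Rightarrow> power_series" where
  "monomial_sum A w = Power_Series (\<lambda>m. real (card {a \<in> A. w a = m}))"

definition chromatic_symmetric_function :: "'a set \<Rightarrow> 'a set set \<Rightarrow> power_series" where
  "chromatic_symmetric_function V E =
     monomial_sum (proper_colorings V E) (\<lambda>\<kappa>. \<Sum>v\<in>V. Poly_Mapping.single (\<kappa> v) 1)"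

text \<open>A strictly increasing sequence \<open>j\<^sub>1 < \<dots> < j\<^sub>i\<close> is encoded by its set of values.\<close>

definition elementary :: "nat \<Rightarrow> power_series" where
  "elementary i =
     monomial_sum {S. S \<subseteq> {1..} \<and> finite S \<and> card S = i} (\<lambda>S. \<Sum>j\<in>S. Poly_Mapping.single j 1)"

text \<open>Partitions are multisets of positive parts.\<close>

definition is_partition :: "nat multiset \<Rightarrow> bool" where
  "is_partition lam \<longleftrightarrow> 0 \<notin># lam"

definition elementary_partition :: "nat multiset \<Rightarrow> power_series" where
  "elementary_partition lam = (\<Prod>i\<in>#lam. elementary i)"

definition e_positive :: "power_series \<Rightarrow> bool" where
  "e_positive f \<longleftrightarrow>
     (\<exists>P c. finite P \<and> (\<forall>lam\<in>P. is_partition lam \<and> c lam \<ge> (0 :: real)) \<and>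
        f = (\<Sum>lam\<in>P. c lam *\<^sub>R elementary_partition lam))"


section \<open>The formal sums above are well defined\<close>

lemma finite_coloring_fibre:
  assumes "finite V"
  shows "finite {\<kappa> \<in> proper_colorings V E. (\<Sum>v\<in>V. Poly_Mapping.single (\<kappa> v) 1) = (m :: monomial)}"
proof (rule finite_subset)
  show "{\<kappa> \<in> proper_colorings V E. (\<Sum>v\<in>V. Poly_Mapping.single (\<kappa> v) 1) = m} \<subseteq> V \<rightarrow>\<^sub>E Poly_Mapping.keys m"
  proof (rule subsetI)
    fix \<kappa>
    assume "\<kappa> \<in> {\<kappa> \<in> proper_colorings V E. (\<Sum>v\<in>V. Poly_Mapping.single (\<kappa> v) 1) = m}"
    then have k: "\<kappa> \<in> proper_colorings V E" and m: "m = (\<Sum>v\<in>V. Poly_Mapping.single (\<kappa> v) 1)"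
      by auto
    have "\<kappa> u \<in> Poly_Mapping.keys m" if "u \<in> V" for u
    proof -
      have "Poly_Mapping.lookup m (\<kappa> u) = (\<Sum>v\<in>V. Poly_Mapping.lookup (Poly_Mapping.single (\<kappa> v) 1) (\<kappa> u))"
        by (simp add: m lookup_sum)
      also have "\<dots> \<ge> Poly_Mapping.lookup (Poly_Mapping.single (\<kappa> u) (1 :: nat)) (\<kappa> u)"
        using that assms by (intro member_le_sum) auto
      finally show ?thesis by (simp add: in_keys_iff)
    qed
    then show "\<kappa> \<in> V \<rightarrow>\<^sub>E Poly_Mapping.keys m"
      using k unfolding proper_colorings_def PiE_iff by blast
  qed
  show "finite (V \<rightarrow>\<^sub>E Poly_Mapping.keys m)"
    using assms by (intro finite_PiE) auto
qed

lemma finite_elementary_fibre: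
  "finite {S \<in> {S. S \<subseteq> {1..} \<and> finite S \<and> card S = i}.
     (\<Sum>j\<in>S. Poly_Mapping.single j 1) = (m :: monomial)}"
proof (rule finite_subset)
  show "{S \<in> {S. S \<subseteq> {1..} \<and> finite S \<and> card S = i}.
     (\<Sum>j\<in>S. Poly_Mapping.single j 1) = m} \<subseteq> Pow (Poly_Mapping.keys m)"
  proof safe
    fix S :: "nat set" and j
    assume "finite S" and j: "j \<in> S"
    then have "Poly_Mapping.lookup (\<Sum>j\<in>S. Poly_Mapping.single j (1 :: nat)) j \<ge>
        Poly_Mapping.lookup (Poly_Mapping.single j (1 :: nat)) j"
      unfolding lookup_sum by (intro member_le_sum) auto
    then show "j \<in> Poly_Mapping.keys (\<Sum>j\<in>S. Poly_Mapping.single j (1 :: nat))"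
      by (simp add: in_keys_iff)
  qed
qed simp

end

theory Submission
  imports Defs "HOL-Combinatorics.Transposition"
begin

text \<open>
The structure of the graph. An isolated vertex contributes a factor \<open>e\<^sub>1\<close>, so suppose that every
vertex has a neighbour. Let \<open>u\<close> be a vertex with the leftmost interval and \<open>w\<close> one with the
rightmost. If these two intervals meet, the graph is complete and \<open>X\<close> is a multiple of a single
elementary function. Otherwise the remaining vertices form a clique \<open>K\<close>: if \<open>x\<close> and \<open>y\<close> in it were
not adjacent, \<open>x\<close> to the left of \<open>y\<close>, there would be an edge at \<open>u\<close> whose ends do not lie to the
right of \<open>x\<close> and an edge at \<open>w\<close> whose ends do not lie to the left of \<open>y\<close>, and these edges would
induce \<open>2K\<^sub>2\<close> (\<open>middle_is_clique\<close>). So the graph is a clique \<open>K\<close> with two further non-adjacent vertices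
\<open>u\<close> and \<open>w\<close>, whose neighbourhoods \<open>A\<close> and \<open>B\<close> in \<open>K\<close> are disjoint or cover \<open>K\<close>: a vertex in both
intersects \<open>u\<close> and \<open>w\<close>, and then no interval fits strictly between those of \<open>u\<close> and \<open>w\<close>.

The expansion. Write \<open>n\<close>, \<open>a\<close>, \<open>b\<close>, \<open>s\<close> for the sizes of \<open>K\<close>, \<open>A\<close>, \<open>B\<close>, \<open>A \<inter> B\<close>. Since the colours on \<open>K\<close> are
distinct, \<open>u\<close> agrees in colour with at most one vertex of \<open>K\<close>, and so does \<open>w\<close>. Hence
\<open>X = \<alpha> - (a + b) \<beta> + (a b - s) \<gamma> + s \<delta>\<close>, where \<open>\<alpha>\<close> sums over all colourings that are injective on
\<open>K\<close>, \<open>\<beta>\<close> over those in which \<open>u\<close> has the colour of a given \<open>k \<in> K\<close>, \<open>\<gamma>\<close> over those in which \<open>u\<close> and \<open>w\<close> have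
the colours of two given different vertices of \<open>K\<close>, and \<open>\<delta>\<close> over those in which both have the
colour of the same given vertex. By symmetry these four depend on \<open>n\<close> only, and the disjoint
unions of cliques \<open>K\<^sub>n + K\<^sub>1 + K\<^sub>1\<close>, \<open>K\<^sub>n + K\<^sub>2\<close>, \<open>K\<^sub>n\<^sub>+\<^sub>1 + K\<^sub>1\<close> and \<open>K\<^sub>n\<^sub>+\<^sub>2\<close>, whose chromatic functions are multiples of
products of elementary functions, determine them (\<open>clique_plus_two_vertices\<close>). Solving the linear
equations gives, for \<open>n \<ge> 2\<close>, that \<open>n (n - 1) X / n!\<close> is the sum of
  \<^item> \<open>(n - 1) (n - a - b + s)\<close> times \<open>e\<^sub>n e\<^sub>1 e\<^sub>1\<close>,
  \<^item> \<open>2 (a b - n s)\<close> times \<open>e\<^sub>n e\<^sub>2\<close>,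
  \<^item> \<open>(n\<^sup>2 - 1) (a + b) - 2 n a b + (n + 1) s\<close> times \<open>e\<^sub>n\<^sub>+\<^sub>1 e\<^sub>1\<close>, and
  \<^item> \<open>(n + 2) (n - 1) a b\<close> times \<open>e\<^sub>n\<^sub>+\<^sub>2\<close>.

The first and the last coefficient are nonnegative for all \<open>A\<close> and \<open>B\<close>. The middle ones are where the
shape matters: if \<open>A\<close> and \<open>B\<close> are disjoint then \<open>s = 0\<close>, and if they cover \<open>K\<close> then \<open>s = a + b - n\<close> and
\<open>a b - n s = (n - a) (n - b)\<close>; in both cases the third coefficient is nonnegative by the inequality
of the arithmetic and the geometric mean.
\<close>

section \<open>Weighted sums over colourings\<close>

definition colouring_weight :: "'a set \<Rightarrow> ('a \<Rightarrow> nat) \<Rightarrow> monomial" where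
  "colouring_weight V \<kappa> = (\<Sum>v\<in>V. Poly_Mapping.single (\<kappa> v) 1)"

text \<open>Arbitrary conditions \<open>P\<close> are allowed, not only properness for a graph, because inclusion and
exclusion over edges produces conditions that require equal colours.\<close>

definition colour_sum :: "'a set \<Rightarrow> (('a \<Rightarrow> nat) \<Rightarrow> bool) \<Rightarrow> power_series" where
  "colour_sum V P = monomial_sum {\<kappa> \<in> V \<rightarrow>\<^sub>E {1..}. P \<kappa>} (colouring_weight V)"

lemma coeff_monomial_sum: "coeff (monomial_sum A w) m = real (card {a \<in> A. w a = m})"
  by (simp add: monomial_sum_def Power_Series_inverse)

lemma coeff_colour_sum:
  "coeff (colour_sum V P) m = real (card {\<kappa> \<in> V \<rightarrow>\<^sub>E {1..}. P \<kappa> \<and> colouring_weight V \<kappa> = m})"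
  by (simp add: colour_sum_def coeff_monomial_sum conj_assoc)

lemma chromatic_as_colour_sum:
  "chromatic_symmetric_function V E =
     colour_sum V (\<lambda>\<kappa>. \<forall>u\<in>V. \<forall>v\<in>V. {u, v} \<in> E \<longrightarrow> \<kappa> u \<noteq> \<kappa> v)"
  by (simp add: chromatic_symmetric_function_def colour_sum_def proper_colorings_def
      colouring_weight_def[abs_def])

lemma colour_sum_cong:
  assumes "\<And>\<kappa>. \<kappa> \<in> V \<rightarrow>\<^sub>E {1..} \<Longrightarrow> P \<kappa> \<longleftrightarrow> Q \<kappa>"
  shows "colour_sum V P = colour_sum V Q"
proof -
  have "{\<kappa> \<in> V \<rightarrow>\<^sub>E {1..}. P \<kappa>} = {\<kappa> \<in> V \<rightarrow>\<^sub>E {1..}. Q \<kappa>}"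
    using assms by blast
  then show ?thesis by (simp add: colour_sum_def)
qed

lemma finite_colour_fibre:
  assumes "finite V"
  shows "finite {\<kappa> \<in> V \<rightarrow>\<^sub>E {1..}. P \<kappa> \<and> colouring_weight V \<kappa> = m}"
proof (rule finite_subset)
  show "{\<kappa> \<in> V \<rightarrow>\<^sub>E {1..}. P \<kappa> \<and> colouring_weight V \<kappa> = m} \<subseteq>
      {\<kappa> \<in> proper_colorings V {}. (\<Sum>v\<in>V. Poly_Mapping.single (\<kappa> v) 1) = m}"
    by (auto simp: proper_colorings_def colouring_weight_def)
  show "finite {\<kappa> \<in> proper_colorings V {}. (\<Sum>v\<in>V. Poly_Mapping.single (\<kappa> v) 1) = m}"
    by (rule finite_coloring_fibre[OF assms])
qed

lemma colour_sum_split: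
  assumes "finite V"
  shows "colour_sum V P = colour_sum V (\<lambda>\<kappa>. P \<kappa> \<and> Q \<kappa>) + colour_sum V (\<lambda>\<kappa>. P \<kappa> \<and> \<not> Q \<kappa>)"
proof (rule power_series_eqI)
  fix m :: monomial
  let ?F = "\<lambda>R. {\<kappa> \<in> V \<rightarrow>\<^sub>E {1..}. R \<kappa> \<and> colouring_weight V \<kappa> = m}"
  have "?F P = ?F (\<lambda>\<kappa>. P \<kappa> \<and> Q \<kappa>) \<union> ?F (\<lambda>\<kappa>. P \<kappa> \<and> \<not> Q \<kappa>)" by blast
  moreover have "?F (\<lambda>\<kappa>. P \<kappa> \<and> Q \<kappa>) \<inter> ?F (\<lambda>\<kappa>. P \<kappa> \<and> \<not> Q \<kappa>) = {}" by blast
  ultimately have "card (?F P) = card (?F (\<lambda>\<kappa>. P \<kappa> \<and> Q \<kappa>)) + card (?F (\<lambda>\<kappa>. P \<kappa> \<and> \<not> Q \<kappa>))"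
    by (simp only: card_Un_disjoint[OF finite_colour_fibre finite_colour_fibre] assms)
  then show "coeff (colour_sum V P) m =
      coeff (colour_sum V (\<lambda>\<kappa>. P \<kappa> \<and> Q \<kappa>) + colour_sum V (\<lambda>\<kappa>. P \<kappa> \<and> \<not> Q \<kappa>)) m"
    by (simp only: coeff_colour_sum plus_power_series.rep_eq of_nat_add)
qed

text \<open>Inclusion and exclusion stops after the first step: as the colours on \<open>A\<close> are distinct, the colour
of \<open>x\<close> occurs at most once on \<open>A\<close>.\<close>

lemma colour_sum_avoid:
  assumes V: "finite V" and "finite A" and "\<And>\<kappa>. \<kappa> \<in> V \<rightarrow>\<^sub>E {1..} \<Longrightarrow> P \<kappa> \<Longrightarrow> inj_on \<kappa> A"
  shows "colour_sum V (\<lambda>\<kappa>. P \<kappa> \<and> \<kappa> x \<notin> \<kappa> ` A) =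
    colour_sum V P - (\<Sum>k\<in>A. colour_sum V (\<lambda>\<kappa>. P \<kappa> \<and> \<kappa> x = \<kappa> k))"
  using assms(2,3)
proof (induction A)
  case empty
  then show ?case by simp
next
  case (insert k A)
  have "colour_sum V (\<lambda>\<kappa>. P \<kappa> \<and> \<kappa> x \<notin> \<kappa> ` A) =
      colour_sum V (\<lambda>\<kappa>. (P \<kappa> \<and> \<kappa> x \<notin> \<kappa> ` A) \<and> \<kappa> x = \<kappa> k) +
      colour_sum V (\<lambda>\<kappa>. (P \<kappa> \<and> \<kappa> x \<notin> \<kappa> ` A) \<and> \<not> \<kappa> x = \<kappa> k)"
    by (rule colour_sum_split[OF V])
  also have "colour_sum V (\<lambda>\<kappa>. (P \<kappa> \<and> \<kappa> x \<notin> \<kappa> ` A) \<and> \<kappa> x = \<kappa> k) =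
      colour_sum V (\<lambda>\<kappa>. P \<kappa> \<and> \<kappa> x = \<kappa> k)"
  proof (rule colour_sum_cong)
    fix \<kappa> :: "'a \<Rightarrow> nat" assume "\<kappa> \<in> V \<rightarrow>\<^sub>E {1..}"
    then show "((P \<kappa> \<and> \<kappa> x \<notin> \<kappa> ` A) \<and> \<kappa> x = \<kappa> k) \<longleftrightarrow> (P \<kappa> \<and> \<kappa> x = \<kappa> k)"
      using insert.prems[of \<kappa>] insert.hyps by (cases "\<kappa> x = \<kappa> k"; cases "P \<kappa>") auto
  qed
  also have "colour_sum V (\<lambda>\<kappa>. (P \<kappa> \<and> \<kappa> x \<notin> \<kappa> ` A) \<and> \<not> \<kappa> x = \<kappa> k) =
      colour_sum V (\<lambda>\<kappa>. P \<kappa> \<and> \<kappa> x \<notin> \<kappa> ` insert k A)"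
    by (intro colour_sum_cong) auto
  finally have step: "colour_sum V (\<lambda>\<kappa>. P \<kappa> \<and> \<kappa> x \<notin> \<kappa> ` insert k A) =
      colour_sum V (\<lambda>\<kappa>. P \<kappa> \<and> \<kappa> x \<notin> \<kappa> ` A) - colour_sum V (\<lambda>\<kappa>. P \<kappa> \<and> \<kappa> x = \<kappa> k)"
    by (simp add: algebra_simps)
  have IH: "colour_sum V (\<lambda>\<kappa>. P \<kappa> \<and> \<kappa> x \<notin> \<kappa> ` A) =
      colour_sum V P - (\<Sum>k\<in>A. colour_sum V (\<lambda>\<kappa>. P \<kappa> \<and> \<kappa> x = \<kappa> k))"
    using insert.prems by (intro insert.IH) simp
  show ?case
    by (simp only: step IH sum.insert[OF insert.hyps] diff_diff_eq add.commute)
qed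

text \<open>Renaming the vertices does not change the monomial of a colouring.\<close>

lemma colour_sum_transpose:
  assumes a: "a \<in> V" and b: "b \<in> V"
  shows "colour_sum V (\<lambda>\<kappa>. P (\<lambda>v. \<kappa> (transpose a b v))) = colour_sum V P"
proof (rule power_series_eqI)
  fix m :: monomial
  let ?t = "transpose a b"
  have ex: "(\<lambda>v. \<kappa> (?t v)) \<in> V \<rightarrow>\<^sub>E {1..}" if "\<kappa> \<in> V \<rightarrow>\<^sub>E {1..}" for \<kappa> :: "'a \<Rightarrow> nat"
    using that a b by (auto simp: PiE_iff extensional_def transpose_def)
  have bij: "bij_betw ?t V V"
    by (rule bij_betw_byWitness[of _ ?t]) (use a b in \<open>auto simp: transpose_def\<close>)
  have wt: "colouring_weight V (\<lambda>v. \<kappa> (?t v)) = colouring_weight V \<kappa>" for \<kappa>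
    unfolding colouring_weight_def by (rule sum.reindex_bij_betw[OF bij])
  have "bij_betw (\<lambda>\<kappa> v. \<kappa> (?t v))
      {\<kappa> \<in> V \<rightarrow>\<^sub>E {1..}. P (\<lambda>v. \<kappa> (?t v)) \<and> colouring_weight V \<kappa> = m}
      {\<kappa> \<in> V \<rightarrow>\<^sub>E {1..}. P \<kappa> \<and> colouring_weight V \<kappa> = m}"
    by (rule bij_betw_byWitness[of _ "\<lambda>\<kappa> v. \<kappa> (?t v)"]) (simp_all add: wt ex image_subset_iff del: One_nat_def)
  then show "coeff (colour_sum V (\<lambda>\<kappa>. P (\<lambda>v. \<kappa> (?t v)))) m = coeff (colour_sum V P) m"
    by (simp add: coeff_colour_sum bij_betw_same_card)
qed

text \<open>A colouring of a disjoint union is a pair of colourings, and its monomial is the product of theirs;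
so the coefficients on both sides count the same pairs.\<close>

lemma colour_sum_disjoint_union:
  assumes fin: "finite V" "finite W" and disj: "V \<inter> W = {}"
  shows "colour_sum (V \<union> W) (\<lambda>\<kappa>. P (restrict \<kappa> V) \<and> Q (restrict \<kappa> W)) = colour_sum V P * colour_sum W Q"
proof (rule power_series_eqI)
  fix m :: monomial
  let ?F = "\<lambda>V P m. {\<kappa> \<in> V \<rightarrow>\<^sub>E {1::nat..}. P \<kappa> \<and> colouring_weight V \<kappa> = m}"
  let ?L = "?F (V \<union> W) (\<lambda>\<kappa>. P (restrict \<kappa> V) \<and> Q (restrict \<kappa> W)) m"
  let ?R = "SIGMA p:splits m. ?F V P (fst p) \<times> ?F W Q (snd p)"
  have wt: "colouring_weight (V \<union> W) \<kappa> = colouring_weight V \<kappa> + colouring_weight W \<kappa>" for \<kappa>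
    unfolding colouring_weight_def by (rule sum.union_disjoint[OF fin disj])
  have wr: "colouring_weight X (restrict \<kappa> X) = colouring_weight X \<kappa>" for X :: "'a set" and \<kappa>
    unfolding colouring_weight_def by (rule sum.cong) auto
  define merge where "merge = (\<lambda>(\<kappa>, \<mu>) v. if v \<in> V then \<kappa> v else (\<mu> :: 'a \<Rightarrow> nat) v)"
  have mV: "restrict (merge (\<kappa>, \<mu>)) V = \<kappa>" if "\<kappa> \<in> V \<rightarrow>\<^sub>E {1..}" for \<kappa> \<mu>
    using that by (auto simp: merge_def fun_eq_iff PiE_iff extensional_def)
  have mW: "restrict (merge (\<kappa>, \<mu>)) W = \<mu>" if "\<mu> \<in> W \<rightarrow>\<^sub>E {1..}" for \<kappa> \<mu>
    using that disj by (auto simp: merge_def fun_eq_iff PiE_iff extensional_def)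
  have mm: "merge (restrict \<kappa> V, restrict \<kappa> W) = \<kappa>" if "\<kappa> \<in> V \<union> W \<rightarrow>\<^sub>E {1..}" for \<kappa>
    using that by (auto simp: merge_def fun_eq_iff PiE_iff extensional_def)
  have wm: "colouring_weight V (merge (\<kappa>, \<mu>)) = colouring_weight V \<kappa>"
      "colouring_weight W (merge (\<kappa>, \<mu>)) = colouring_weight W \<mu>"
    if "\<kappa> \<in> V \<rightarrow>\<^sub>E {1..}" "\<mu> \<in> W \<rightarrow>\<^sub>E {1..}" for \<kappa> \<mu>
    using wr[of V "merge (\<kappa>, \<mu>)"] wr[of W "merge (\<kappa>, \<mu>)"] that by (simp_all add: mV mW)
  have me: "merge (\<kappa>, \<mu>) \<in> V \<union> W \<rightarrow>\<^sub>E {1..}"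
    if "\<kappa> \<in> V \<rightarrow>\<^sub>E {1..}" "\<mu> \<in> W \<rightarrow>\<^sub>E {1..}" for \<kappa> \<mu>
    using that by (auto simp: merge_def PiE_iff extensional_def)
  have re: "restrict \<kappa> V \<in> V \<rightarrow>\<^sub>E {1..}" "restrict \<kappa> W \<in> W \<rightarrow>\<^sub>E {1..}"
    if "\<kappa> \<in> V \<union> W \<rightarrow>\<^sub>E {1..}" for \<kappa> :: "'a \<Rightarrow> nat"
    using that by (auto simp: PiE_iff)
  have "bij_betw (\<lambda>\<kappa>. ((colouring_weight V \<kappa>, colouring_weight W \<kappa>), restrict \<kappa> V, restrict \<kappa> W)) ?L ?R"
  proof (rule bij_betw_byWitness[of _ "\<lambda>q. merge (snd q)"])
    show "\<forall>\<kappa>\<in>?L. merge (snd ((colouring_weight V \<kappa>, colouring_weight W \<kappa>), restrict \<kappa> V, restrict \<kappa> W)) = \<kappa>"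
      using mm by auto
    show "\<forall>q\<in>?R. ((colouring_weight V (merge (snd q)), colouring_weight W (merge (snd q))),
        restrict (merge (snd q)) V, restrict (merge (snd q)) W) = q"
      by (auto simp: mV mW wm simp del: One_nat_def)
    show "(\<lambda>\<kappa>. ((colouring_weight V \<kappa>, colouring_weight W \<kappa>), restrict \<kappa> V, restrict \<kappa> W)) ` ?L \<subseteq> ?R"
      using re by (auto simp: splits_def wt wr)
    show "(\<lambda>q. merge (snd q)) ` ?R \<subseteq> ?L"
    proof (rule image_subsetI)
      fix q assume q: "q \<in> ?R"
      obtain p \<kappa> \<mu> where "q = (p, \<kappa>, \<mu>)" by (cases q)
      with q show "merge (snd q) \<in> ?L"
        by (cases p) (simp add: splits_def wt mV mW wm me del: One_nat_def)
    qed
  qed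
  then have "card ?L = card ?R" by (rule bij_betw_same_card)
  also have "\<dots> = (\<Sum>p\<in>splits m. card (?F V P (fst p)) * card (?F W Q (snd p)))"
    by (subst card_SigmaI)
      (simp_all add: finite_splits card_cartesian_product finite_colour_fibre fin del: One_nat_def)
  finally show "coeff (colour_sum (V \<union> W) (\<lambda>\<kappa>. P (restrict \<kappa> V) \<and> Q (restrict \<kappa> W))) m =
      coeff (colour_sum V P * colour_sum W Q) m"
    by (simp add: coeff_colour_sum times_power_series.rep_eq case_prod_unfold)
qed

text \<open>The monomial of an injective colouring depends only on its set of colours, and each set of
\<open>card V\<close> colours is used by \<open>card V\<close> factorial injective colourings.\<close>

lemma colour_sum_clique:
  assumes "finite V"
  shows "colour_sum V (\<lambda>\<kappa>. inj_on \<kappa> V) = fact (card V) *\<^sub>R elementary (card V)"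
proof (rule power_series_eqI)
  fix m :: monomial
  let ?S = "{S \<in> {S. S \<subseteq> {1..} \<and> finite S \<and> card S = card V}. (\<Sum>j\<in>S. Poly_Mapping.single j 1) = m}"
  let ?I = "\<lambda>S. {\<kappa> \<in> V \<rightarrow>\<^sub>E S. inj_on \<kappa> V}"
  have im: "\<kappa> ` V = S" if "S \<in> ?S" "\<kappa> \<in> ?I S" for S \<kappa>
    using that by (intro card_subset_eq) (auto simp: card_image)
  have wt: "colouring_weight V \<kappa> = (\<Sum>j\<in>\<kappa> ` V. Poly_Mapping.single j 1)" if "inj_on \<kappa> V" for \<kappa>
    using that by (simp add: colouring_weight_def sum.reindex)
  have "{\<kappa> \<in> V \<rightarrow>\<^sub>E {1..}. inj_on \<kappa> V \<and> colouring_weight V \<kappa> = m} = (\<Union>S\<in>?S. ?I S)"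
  proof (intro equalityI subsetI)
    fix \<kappa> assume k: "\<kappa> \<in> {\<kappa> \<in> V \<rightarrow>\<^sub>E {1..}. inj_on \<kappa> V \<and> colouring_weight V \<kappa> = m}"
    then have "\<kappa> ` V \<in> ?S" using wt[of \<kappa>] assms by (auto simp: card_image)
    moreover have "\<kappa> \<in> ?I (\<kappa> ` V)" using k by (auto simp: PiE_iff)
    ultimately show "\<kappa> \<in> (\<Union>S\<in>?S. ?I S)" by blast
  next
    fix \<kappa> assume "\<kappa> \<in> (\<Union>S\<in>?S. ?I S)"
    then obtain S where S: "S \<in> ?S" "\<kappa> \<in> ?I S" by blast
    then show "\<kappa> \<in> {\<kappa> \<in> V \<rightarrow>\<^sub>E {1..}. inj_on \<kappa> V \<and> colouring_weight V \<kappa> = m}"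
    proof -
      have "colouring_weight V \<kappa> = m" using im[OF S] wt[of \<kappa>] S by simp
      then show ?thesis using S by (auto simp: PiE_iff)
    qed
  qed
  moreover have "card (\<Union>S\<in>?S. ?I S) = (\<Sum>S\<in>?S. card (?I S))"
  proof (rule card_UN_disjoint)
    show "finite ?S" by (rule finite_elementary_fibre)
    show "\<forall>S\<in>?S. finite (?I S)" using assms by (auto intro!: finite_PiE)
    show "\<forall>S\<in>?S. \<forall>T\<in>?S. S \<noteq> T \<longrightarrow> ?I S \<inter> ?I T = {}"
    proof (intro ballI impI equals0I)
      fix S T \<kappa> assume "S \<in> ?S" "T \<in> ?S" "S \<noteq> T" "\<kappa> \<in> ?I S \<inter> ?I T"
      then show False using im[of S \<kappa>] im[of T \<kappa>] by simp
    qed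
  qed
  moreover have "(\<Sum>S\<in>?S. card (?I S)) = (\<Sum>S\<in>?S. fact (card V))"
  proof (rule sum.cong)
    fix S assume "S \<in> ?S"
    then show "card (?I S) = fact (card V)"
      using assms
      by (simp add: card_inj_on_subset_funcset[OF assms] fact_prod_rev)
  qed simp
  ultimately show "coeff (colour_sum V (\<lambda>\<kappa>. inj_on \<kappa> V)) m = coeff (fact (card V) *\<^sub>R elementary (card V)) m"
    by (simp add: coeff_colour_sum elementary_def coeff_monomial_sum scaleR_power_series.rep_eq)
qed


section \<open>Colour coincidences with a clique\<close>

lemma inj_on_transpose_iff:
  assumes "a \<in> K" "b \<in> K"
  shows "inj_on (\<lambda>v. \<kappa> (transpose a b v)) K \<longleftrightarrow> inj_on \<kappa> K"
proof -
  have "transpose a b ` K = K"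
    using assms by simp
  then show ?thesis
    using comp_inj_on_iff[of "transpose a b" K \<kappa>] by (simp add: comp_def)
qed

lemma colour_sum_match_const:
  assumes "K \<subseteq> V" "x \<notin> K" "k \<in> K" "k' \<in> K"
  shows "colour_sum V (\<lambda>\<kappa>. inj_on \<kappa> K \<and> \<kappa> x = \<kappa> k) = colour_sum V (\<lambda>\<kappa>. inj_on \<kappa> K \<and> \<kappa> x = \<kappa> k')"
proof -
  have "transpose k k' x = x" using assms by (auto intro: transpose_apply_other)
  then show ?thesis
    using colour_sum_transpose[of k V k' "\<lambda>\<kappa>. inj_on \<kappa> K \<and> \<kappa> x = \<kappa> k"] assms
    by (simp add: inj_on_transpose_iff subset_iff)
qed

text \<open>Joining \<open>x\<close> to all of the clique \<open>K\<close> removes the colourings in which \<open>x\<close> agrees with one of its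
vertices, and by symmetry all \<open>card K\<close> choices of that vertex contribute equally. This expresses the
sum over colourings with a prescribed coincidence through sums over larger and smaller cliques.\<close>

lemma colour_sum_match:
  assumes "finite V" "K \<subseteq> V" "x \<notin> K" "k \<in> K"
  shows "real (card K) *\<^sub>R colour_sum V (\<lambda>\<kappa>. inj_on \<kappa> K \<and> \<kappa> x = \<kappa> k) =
    colour_sum V (\<lambda>\<kappa>. inj_on \<kappa> K) - colour_sum V (\<lambda>\<kappa>. inj_on \<kappa> (insert x K))"
proof -
  have "finite K" using assms finite_subset by blast
  have "colour_sum V (\<lambda>\<kappa>. inj_on \<kappa> (insert x K)) = colour_sum V (\<lambda>\<kappa>. inj_on \<kappa> K \<and> \<kappa> x \<notin> \<kappa> ` K)"
    using assms(3) by (intro colour_sum_cong) simp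
  also have "\<dots> = colour_sum V (\<lambda>\<kappa>. inj_on \<kappa> K) -
      (\<Sum>j\<in>K. colour_sum V (\<lambda>\<kappa>. inj_on \<kappa> K \<and> \<kappa> x = \<kappa> j))"
    by (rule colour_sum_avoid[OF assms(1) \<open>finite K\<close>])
  also have "(\<Sum>j\<in>K. colour_sum V (\<lambda>\<kappa>. inj_on \<kappa> K \<and> \<kappa> x = \<kappa> j)) =
      (\<Sum>j\<in>K. colour_sum V (\<lambda>\<kappa>. inj_on \<kappa> K \<and> \<kappa> x = \<kappa> k))"
    using assms by (intro sum.cong colour_sum_match_const) auto
  finally show ?thesis by (simp add: sum_constant_scaleR del: sum_constant)
qed

lemma colour_sum_two_cliques:
  assumes "finite V" "finite W" "V \<inter> W = {}"
  shows "colour_sum (V \<union> W) (\<lambda>\<kappa>. inj_on \<kappa> V \<and> inj_on \<kappa> W) =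
    (fact (card V) * fact (card W)) *\<^sub>R (elementary (card V) * elementary (card W))"
  using colour_sum_disjoint_union[OF assms, of "\<lambda>\<kappa>. inj_on \<kappa> V" "\<lambda>\<kappa>. inj_on \<kappa> W"]
  by (simp add: colour_sum_clique assms)

lemma colour_sum_pair_const:
  assumes KV: "K \<subseteq> V" and x: "x \<notin> K" and y: "y \<notin> K"
    and k: "k \<in> K" "k' \<in> K" "k \<noteq> k'" and l: "l \<in> K" "l' \<in> K" "l \<noteq> l'"
  shows "colour_sum V (\<lambda>\<kappa>. inj_on \<kappa> K \<and> \<kappa> x = \<kappa> k \<and> \<kappa> y = \<kappa> k') =
    colour_sum V (\<lambda>\<kappa>. inj_on \<kappa> K \<and> \<kappa> x = \<kappa> l \<and> \<kappa> y = \<kappa> l')"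
proof -
  let ?g = "\<lambda>i j. colour_sum V (\<lambda>\<kappa>. inj_on \<kappa> K \<and> \<kappa> x = \<kappa> i \<and> \<kappa> y = \<kappa> j)"
  have tr: "?g i j = ?g (transpose a b i) (transpose a b j)" if "a \<in> K" "b \<in> K" for a b i j
  proof -
    have "transpose a b x = x" "transpose a b y = y"
      using that x y by (auto intro: transpose_apply_other)
    then show ?thesis
      using colour_sum_transpose[of a V b "\<lambda>\<kappa>. inj_on \<kappa> K \<and> \<kappa> x = \<kappa> i \<and> \<kappa> y = \<kappa> j"] that KV
      by (simp add: inj_on_transpose_iff subset_iff)
  qed
  \<comment> \<open>Move \<open>k\<close> to \<open>l\<close> first; this may also move \<open>k'\<close>, namely when \<open>k' = l\<close>, but never onto \<open>l\<close>, so a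
    second transposition that fixes \<open>l\<close> can bring the other vertex to \<open>l'\<close>.\<close>
  have "?g k k' = ?g l (transpose k l k')"
    using tr[of k l k k'] k l by simp
  also have "\<dots> = ?g l l'"
  proof -
    have "transpose k l k' \<in> K" "transpose k l k' \<noteq> l"
      using k l by (auto simp: transpose_def)
    then show ?thesis
      using tr[of "transpose k l k'" l' l "transpose k l k'"] l by (simp add: transpose_def)
  qed
  finally show ?thesis .
qed

lemma colour_sum_both_const:
  assumes "K \<subseteq> V" "x \<notin> K" "y \<notin> K" "k \<in> K" "l \<in> K"
  shows "colour_sum V (\<lambda>\<kappa>. inj_on \<kappa> K \<and> \<kappa> x = \<kappa> k \<and> \<kappa> y = \<kappa> k) =
    colour_sum V (\<lambda>\<kappa>. inj_on \<kappa> K \<and> \<kappa> x = \<kappa> l \<and> \<kappa> y = \<kappa> l)"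
proof -
  have "transpose k l x = x" "transpose k l y = y"
    using assms by (auto intro: transpose_apply_other)
  then show ?thesis
    using colour_sum_transpose[of k V l "\<lambda>\<kappa>. inj_on \<kappa> K \<and> \<kappa> x = \<kappa> k \<and> \<kappa> y = \<kappa> k"] assms
    by (simp add: inj_on_transpose_iff subset_iff)
qed

text \<open>The last conclusion is inclusion and exclusion over the edges from \<open>u\<close> to \<open>A\<close> and from \<open>w\<close> to \<open>B\<close>. The
three equations before it determine \<open>\<beta>\<close>, \<open>\<delta>\<close> and, when \<open>n \<ge> 2\<close>, \<open>\<gamma>\<close>. Here \<open>\<tau>\<close> is the sum over the
colourings with \<open>u\<close> and \<open>w\<close> of equal colour, so that \<open>\<tau> - n \<delta>\<close> is the part in which this colour does
not occur on \<open>K\<close>. The first equation compares the clique \<open>K\<close> with the clique \<open>K \<union> {u}\<close>, the second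
compares \<open>K \<union> {u}\<close> with \<open>K \<union> {u, w}\<close>. The third uses that, once \<open>u\<close> is joined to all of \<open>K\<close>, the vertex \<open>w\<close>
agrees with a vertex of \<open>K\<close> as often as with \<open>u\<close>.\<close>

lemma clique_plus_two_vertices:
  fixes K :: "'a set" and u w :: 'a
  assumes fin: "finite K" and uw: "u \<notin> K" "w \<notin> K" "u \<noteq> w" and ne: "K \<noteq> {}"
    and AB: "A \<subseteq> K" "B \<subseteq> K"
  defines "V \<equiv> insert u (insert w K)" and "n \<equiv> card K"
  defines "\<alpha> \<equiv> fact n *\<^sub>R (elementary n * elementary 1 * elementary 1)"
  defines "\<tau> \<equiv> \<alpha> - (2 * fact n) *\<^sub>R (elementary n * elementary 2)"
  obtains \<beta> \<gamma> \<delta> where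
    "real n *\<^sub>R \<beta> = \<alpha> - fact (n + 1) *\<^sub>R (elementary (n + 1) * elementary 1)"
    "real (n + 1) *\<^sub>R (\<tau> - real n *\<^sub>R \<delta>) =
       fact (n + 1) *\<^sub>R (elementary (n + 1) * elementary 1) - fact (n + 2) *\<^sub>R elementary (n + 2)"
    "\<beta> - (real n - 1) *\<^sub>R \<gamma> - \<delta> = \<tau> - real n *\<^sub>R \<delta>"
    "colour_sum V (\<lambda>\<kappa>. inj_on \<kappa> K \<and> \<kappa> u \<notin> \<kappa> ` A \<and> \<kappa> w \<notin> \<kappa> ` B) =
       \<alpha> - real (card A + card B) *\<^sub>R \<beta> +
       (real (card A) * real (card B) - real (card (A \<inter> B))) *\<^sub>R \<gamma> + real (card (A \<inter> B)) *\<^sub>R \<delta>"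
proof -
  let ?C = "colour_sum V" and ?I = "\<lambda>\<kappa> :: 'a \<Rightarrow> nat. inj_on \<kappa> K"
  have finV: "finite V" and KV: "K \<subseteq> V" and uV: "u \<in> V" and wV: "w \<in> V"
    using fin by (auto simp: V_def)
  have finA: "finite A" and finB: "finite B" using fin AB finite_subset by auto
  obtain k0 where k0: "k0 \<in> K" using ne by blast
  have free: "?C ?I = \<alpha>"
  proof -
    have "?C ?I = colour_sum (K \<union> ({u} \<union> {w})) (\<lambda>\<kappa>. inj_on (restrict \<kappa> K) K \<and> True)"
      by (simp add: V_def insert_commute)
    also have "\<dots> = colour_sum K ?I * colour_sum ({u} \<union> {w}) (\<lambda>_. True)"
      using fin uw by (intro colour_sum_disjoint_union) auto
    also have "colour_sum ({u} \<union> {w}) (\<lambda>_. True) = elementary 1 * elementary 1"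
      using colour_sum_two_cliques[of "{u}" "{w}"] uw by simp
    finally show ?thesis by (simp add: \<alpha>_def colour_sum_clique fin n_def mult.assoc)
  qed
  have joined: "?C (\<lambda>\<kappa>. inj_on \<kappa> (insert u K)) = fact (n + 1) *\<^sub>R (elementary (n + 1) * elementary 1)"
  proof -
    have "V = insert u K \<union> {w}" by (auto simp: V_def)
    then show ?thesis
      using colour_sum_two_cliques[of "insert u K" "{w}"] fin uw by (simp add: n_def)
  qed
  have all: "?C (\<lambda>\<kappa>. inj_on \<kappa> (insert w (insert u K))) = fact (n + 2) *\<^sub>R elementary (n + 2)"
  proof -
    have "V = insert w (insert u K)" by (auto simp: V_def)
    then show ?thesis
      using colour_sum_clique[of "insert w (insert u K)"] fin uw by (simp add: n_def)
  qed
  have equal: "?C (\<lambda>\<kappa>. ?I \<kappa> \<and> \<kappa> u = \<kappa> w) = \<tau>"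
  proof -
    have "?C (\<lambda>\<kappa>. ?I \<kappa> \<and> \<not> \<kappa> u = \<kappa> w) = colour_sum (K \<union> {u, w}) (\<lambda>\<kappa>. ?I \<kappa> \<and> inj_on \<kappa> {u, w})"
      using uw by (auto simp: V_def insert_commute intro!: colour_sum_cong)
    also have "\<dots> = (2 * fact n) *\<^sub>R (elementary n * elementary 2)"
      using colour_sum_two_cliques[of K "{u, w}"] fin uw by (simp add: n_def numeral_2_eq_2 mult.commute)
    finally show ?thesis
      using colour_sum_split[OF finV, of ?I "\<lambda>\<kappa>. \<kappa> u = \<kappa> w"] free by (simp add: \<tau>_def algebra_simps)
  qed
  define \<beta> where "\<beta> = ?C (\<lambda>\<kappa>. ?I \<kappa> \<and> \<kappa> u = \<kappa> k0)"
  define \<delta> where "\<delta> = ?C (\<lambda>\<kappa>. ?I \<kappa> \<and> \<kappa> u = \<kappa> k0 \<and> \<kappa> w = \<kappa> k0)"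
  obtain \<gamma> where \<gamma>: "?C (\<lambda>\<kappa>. ?I \<kappa> \<and> \<kappa> u = \<kappa> k \<and> \<kappa> w = \<kappa> k') = \<gamma>"
    if "k \<in> K" "k' \<in> K" "k \<noteq> k'" for k k'
  proof (cases "\<exists>i\<in>K. \<exists>j\<in>K. i \<noteq> j")
    case True
    then obtain i j where "i \<in> K" "j \<in> K" "i \<noteq> j" by blast
    then show thesis
      using KV uw by (intro that[of "?C (\<lambda>\<kappa>. ?I \<kappa> \<and> \<kappa> u = \<kappa> i \<and> \<kappa> w = \<kappa> j)"] colour_sum_pair_const)
  next
    case False
    \<comment> \<open>If \<open>K\<close> is a single vertex, \<open>\<gamma>\<close> is arbitrary: its factors \<open>n - 1\<close> and \<open>a b - s\<close> vanish.\<close>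
    then show thesis using that[of 0] by blast
  qed
  have u_match: "?C (\<lambda>\<kappa>. ?I \<kappa> \<and> \<kappa> u = \<kappa> k) = \<beta>" if "k \<in> K" for k
    unfolding \<beta>_def by (rule colour_sum_match_const) (use KV uw that k0 in auto)
  have w_match: "?C (\<lambda>\<kappa>. ?I \<kappa> \<and> \<kappa> w = \<kappa> k) = \<beta>" if "k \<in> K" for k
  proof -
    have "transpose u w ` K = K" "transpose u w k = k"
      using uw that by (auto simp: transpose_def image_iff)
    moreover from this(1) have "inj_on (\<lambda>v. \<kappa> (transpose u w v)) K \<longleftrightarrow> ?I \<kappa>" for \<kappa>
      using comp_inj_on_iff[of "transpose u w" K \<kappa>] by (simp add: comp_def)
    ultimately show ?thesis
      using colour_sum_transpose[OF uV wV, of "\<lambda>\<kappa>. ?I \<kappa> \<and> \<kappa> w = \<kappa> k"] u_match[OF that]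
      by simp
  qed
  have both: "?C (\<lambda>\<kappa>. ?I \<kappa> \<and> \<kappa> u = \<kappa> k \<and> \<kappa> w = \<kappa> k') = (if k = k' then \<delta> else \<gamma>)"
    if kk: "k \<in> K" "k' \<in> K" for k k'
  proof (cases "k = k'")
    case True
    then show ?thesis
      using colour_sum_both_const[of K V u w k k0] KV uw kk k0 by (simp add: \<delta>_def)
  next
    case False
    then show ?thesis using \<gamma>[OF kk] by simp
  qed
  have sum_both: "(\<Sum>j\<in>S. if j = k then \<delta> else \<gamma>) = (real (card S) - of_bool (k \<in> S)) *\<^sub>R \<gamma> + of_bool (k \<in> S) *\<^sub>R \<delta>"
    if "finite S" for S k
  proof -
    have "(\<Sum>j\<in>S. if j = k then \<delta> else \<gamma>) = (\<Sum>j\<in>S. \<gamma> + (if j = k then \<delta> - \<gamma> else 0))"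
      by (rule sum.cong) auto
    also have "\<dots> = real (card S) *\<^sub>R \<gamma> + (if k \<in> S then \<delta> - \<gamma> else 0)"
      using that by (simp add: sum.distrib sum_constant_scaleR del: sum_constant)
    finally show ?thesis by (simp add: algebra_simps)
  qed
  have avoid_both: "?C (\<lambda>\<kappa>. (?I \<kappa> \<and> \<kappa> w = \<kappa> k) \<and> \<kappa> u \<notin> \<kappa> ` S) =
      \<beta> - ((real (card S) - of_bool (k \<in> S)) *\<^sub>R \<gamma> + of_bool (k \<in> S) *\<^sub>R \<delta>)"
    if "S \<subseteq> K" "k \<in> K" for S k
  proof -
    have finS: "finite S" using that fin finite_subset by blast
    have "?C (\<lambda>\<kappa>. (?I \<kappa> \<and> \<kappa> w = \<kappa> k) \<and> \<kappa> u \<notin> \<kappa> ` S) = ?C (\<lambda>\<kappa>. ?I \<kappa> \<and> \<kappa> w = \<kappa> k) -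
        (\<Sum>j\<in>S. ?C (\<lambda>\<kappa>. (?I \<kappa> \<and> \<kappa> w = \<kappa> k) \<and> \<kappa> u = \<kappa> j))"
      using that by (intro colour_sum_avoid finV finS) (auto intro: inj_on_subset)
    also have "(\<Sum>j\<in>S. ?C (\<lambda>\<kappa>. (?I \<kappa> \<and> \<kappa> w = \<kappa> k) \<and> \<kappa> u = \<kappa> j)) = (\<Sum>j\<in>S. if j = k then \<delta> else \<gamma>)"
    proof (rule sum.cong)
      fix j assume "j \<in> S"
      then have "?C (\<lambda>\<kappa>. ?I \<kappa> \<and> \<kappa> u = \<kappa> j \<and> \<kappa> w = \<kappa> k) = (if j = k then \<delta> else \<gamma>)"
        using that by (intro both) auto
      moreover have "?C (\<lambda>\<kappa>. (?I \<kappa> \<and> \<kappa> w = \<kappa> k) \<and> \<kappa> u = \<kappa> j) =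
          ?C (\<lambda>\<kappa>. ?I \<kappa> \<and> \<kappa> u = \<kappa> j \<and> \<kappa> w = \<kappa> k)"
        by (rule colour_sum_cong) auto
      ultimately show "?C (\<lambda>\<kappa>. (?I \<kappa> \<and> \<kappa> w = \<kappa> k) \<and> \<kappa> u = \<kappa> j) = (if j = k then \<delta> else \<gamma>)"
        by simp
    qed simp
    finally show ?thesis by (simp add: sum_both[OF finS] w_match that)
  qed
  have last: "?C (\<lambda>\<kappa>. inj_on \<kappa> (insert u K) \<and> \<kappa> w = \<kappa> u) = \<tau> - real n *\<^sub>R \<delta>"
  proof -
    have "?C (\<lambda>\<kappa>. inj_on \<kappa> (insert u K) \<and> \<kappa> w = \<kappa> u) = ?C (\<lambda>\<kappa>. (?I \<kappa> \<and> \<kappa> u = \<kappa> w) \<and> \<kappa> u \<notin> \<kappa> ` K)"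
      using uw by (intro colour_sum_cong) auto
    also have "\<dots> = ?C (\<lambda>\<kappa>. ?I \<kappa> \<and> \<kappa> u = \<kappa> w) - (\<Sum>k\<in>K. ?C (\<lambda>\<kappa>. (?I \<kappa> \<and> \<kappa> u = \<kappa> w) \<and> \<kappa> u = \<kappa> k))"
      by (rule colour_sum_avoid[OF finV fin]) simp
    also have "(\<Sum>k\<in>K. ?C (\<lambda>\<kappa>. (?I \<kappa> \<and> \<kappa> u = \<kappa> w) \<and> \<kappa> u = \<kappa> k)) = (\<Sum>k\<in>K. \<delta>)"
    proof (rule sum.cong)
      fix k assume "k \<in> K"
      then have "?C (\<lambda>\<kappa>. ?I \<kappa> \<and> \<kappa> u = \<kappa> k \<and> \<kappa> w = \<kappa> k) = \<delta>" using both[of k k] by simp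
      moreover have "?C (\<lambda>\<kappa>. (?I \<kappa> \<and> \<kappa> u = \<kappa> w) \<and> \<kappa> u = \<kappa> k) =
          ?C (\<lambda>\<kappa>. ?I \<kappa> \<and> \<kappa> u = \<kappa> k \<and> \<kappa> w = \<kappa> k)"
        by (rule colour_sum_cong) auto
      ultimately show "?C (\<lambda>\<kappa>. (?I \<kappa> \<and> \<kappa> u = \<kappa> w) \<and> \<kappa> u = \<kappa> k) = \<delta>" by simp
    qed simp
    finally show ?thesis by (simp add: equal n_def sum_constant_scaleR del: sum_constant)
  qed
  show thesis
  proof (rule that[of \<beta> \<delta> \<gamma>])
    show "real n *\<^sub>R \<beta> = \<alpha> - fact (n + 1) *\<^sub>R (elementary (n + 1) * elementary 1)"
      using colour_sum_match[OF finV KV uw(1) k0] free joined by (simp add: \<beta>_def n_def)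
    show "real (n + 1) *\<^sub>R (\<tau> - real n *\<^sub>R \<delta>) =
       fact (n + 1) *\<^sub>R (elementary (n + 1) * elementary 1) - fact (n + 2) *\<^sub>R elementary (n + 2)"
      using colour_sum_match[OF finV, of "insert u K" w u] KV uV uw fin joined all last
      by (simp add: n_def)
    have "?C (\<lambda>\<kappa>. inj_on \<kappa> (insert u K) \<and> \<kappa> w = \<kappa> k0) = ?C (\<lambda>\<kappa>. inj_on \<kappa> (insert u K) \<and> \<kappa> w = \<kappa> u)"
      using KV uV uw k0 by (intro colour_sum_match_const) auto
    moreover have "?C (\<lambda>\<kappa>. inj_on \<kappa> (insert u K) \<and> \<kappa> w = \<kappa> k0) =
        ?C (\<lambda>\<kappa>. (?I \<kappa> \<and> \<kappa> w = \<kappa> k0) \<and> \<kappa> u \<notin> \<kappa> ` K)"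
      using uw by (intro colour_sum_cong) auto
    ultimately show "\<beta> - (real n - 1) *\<^sub>R \<gamma> - \<delta> = \<tau> - real n *\<^sub>R \<delta>"
      using avoid_both[of K k0] k0 last by (simp add: n_def diff_diff_eq)
    have "?C (\<lambda>\<kappa>. ?I \<kappa> \<and> \<kappa> u \<notin> \<kappa> ` A \<and> \<kappa> w \<notin> \<kappa> ` B) =
        ?C (\<lambda>\<kappa>. (?I \<kappa> \<and> \<kappa> u \<notin> \<kappa> ` A) \<and> \<kappa> w \<notin> \<kappa> ` B)"
      by (rule colour_sum_cong) auto
    also have "\<dots> = ?C (\<lambda>\<kappa>. ?I \<kappa> \<and> \<kappa> u \<notin> \<kappa> ` A) -
        (\<Sum>k\<in>B. ?C (\<lambda>\<kappa>. (?I \<kappa> \<and> \<kappa> u \<notin> \<kappa> ` A) \<and> \<kappa> w = \<kappa> k))"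
      using AB by (intro colour_sum_avoid finV finB) (auto intro: inj_on_subset)
    also have "?C (\<lambda>\<kappa>. ?I \<kappa> \<and> \<kappa> u \<notin> \<kappa> ` A) = \<alpha> - (\<Sum>k\<in>A. \<beta>)"
    proof -
      have "?C (\<lambda>\<kappa>. ?I \<kappa> \<and> \<kappa> u \<notin> \<kappa> ` A) = ?C ?I - (\<Sum>k\<in>A. ?C (\<lambda>\<kappa>. ?I \<kappa> \<and> \<kappa> u = \<kappa> k))"
        using AB by (intro colour_sum_avoid finV finA) (auto intro: inj_on_subset)
      also have "(\<Sum>k\<in>A. ?C (\<lambda>\<kappa>. ?I \<kappa> \<and> \<kappa> u = \<kappa> k)) = (\<Sum>k\<in>A. \<beta>)"
        using AB by (intro sum.cong u_match) auto
      finally show ?thesis by (simp add: free)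
    qed
    also have "(\<Sum>k\<in>B. ?C (\<lambda>\<kappa>. (?I \<kappa> \<and> \<kappa> u \<notin> \<kappa> ` A) \<and> \<kappa> w = \<kappa> k)) =
        (\<Sum>k\<in>B. (\<beta> - real (card A) *\<^sub>R \<gamma>) - (if k \<in> A then \<delta> - \<gamma> else 0))"
    proof (rule sum.cong)
      fix k assume "k \<in> B"
      then have "k \<in> K" using AB by blast
      have "?C (\<lambda>\<kappa>. (?I \<kappa> \<and> \<kappa> u \<notin> \<kappa> ` A) \<and> \<kappa> w = \<kappa> k) =
          ?C (\<lambda>\<kappa>. (?I \<kappa> \<and> \<kappa> w = \<kappa> k) \<and> \<kappa> u \<notin> \<kappa> ` A)"
        by (rule colour_sum_cong) auto
      then show "?C (\<lambda>\<kappa>. (?I \<kappa> \<and> \<kappa> u \<notin> \<kappa> ` A) \<and> \<kappa> w = \<kappa> k) =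
          (\<beta> - real (card A) *\<^sub>R \<gamma>) - (if k \<in> A then \<delta> - \<gamma> else 0)"
        using avoid_both[OF AB(1) \<open>k \<in> K\<close>] by (cases "k \<in> A") (simp_all add: algebra_simps)
    qed simp
    also have "\<dots> = real (card B) *\<^sub>R (\<beta> - real (card A) *\<^sub>R \<gamma>) - real (card (A \<inter> B)) *\<^sub>R (\<delta> - \<gamma>)"
      using finB by (simp add: sum_subtractf sum_constant_scaleR sum.If_cases Int_commute Int_def scaleR_diff_right
          del: sum_constant)
    finally show "?C (\<lambda>\<kappa>. ?I \<kappa> \<and> \<kappa> u \<notin> \<kappa> ` A \<and> \<kappa> w \<notin> \<kappa> ` B) =
       \<alpha> - real (card A + card B) *\<^sub>R \<beta> +
       (real (card A) * real (card B) - real (card (A \<inter> B))) *\<^sub>R \<gamma> + real (card (A \<inter> B)) *\<^sub>R \<delta>"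
      by (simp add: sum_constant_scaleR algebra_simps del: sum_constant)
  qed
qed

section \<open>The cone of e-positive functions\<close>

lemma e_positive_elementary_partition:
  assumes "is_partition lam"
  shows "e_positive (elementary_partition lam)"
  unfolding e_positive_def
  by (rule exI[of _ "{lam}"], rule exI[of _ "\<lambda>_. 1"]) (use assms in simp)

lemma e_positive_add:
  assumes "e_positive f" "e_positive g"
  shows "e_positive (f + g)"
proof -
  from assms obtain P c Q d where P: "finite P" "\<forall>lam\<in>P. is_partition lam \<and> c lam \<ge> (0 :: real)"
    "f = (\<Sum>lam\<in>P. c lam *\<^sub>R elementary_partition lam)"
    and Q: "finite Q" "\<forall>lam\<in>Q. is_partition lam \<and> d lam \<ge> (0 :: real)"
    "g = (\<Sum>lam\<in>Q. d lam *\<^sub>R elementary_partition lam)"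
    unfolding e_positive_def by blast
  let ?c = "\<lambda>lam. if lam \<in> P then c lam else 0" and ?d = "\<lambda>lam. if lam \<in> Q then d lam else 0"
  have "f = (\<Sum>lam\<in>P \<union> Q. ?c lam *\<^sub>R elementary_partition lam)"
    unfolding P(3) using P(1) Q(1) by (intro sum.mono_neutral_cong_left) auto
  moreover have "g = (\<Sum>lam\<in>P \<union> Q. ?d lam *\<^sub>R elementary_partition lam)"
    unfolding Q(3) using P(1) Q(1) by (intro sum.mono_neutral_cong_left) auto
  ultimately have "f + g = (\<Sum>lam\<in>P \<union> Q. (?c lam + ?d lam) *\<^sub>R elementary_partition lam)"
    by (simp only: scaleR_add_left sum.distrib)
  then show ?thesis
    unfolding e_positive_def using P(1,2) Q(1,2)
    by (intro exI[of _ "P \<union> Q"] exI[of _ "\<lambda>lam. ?c lam + ?d lam"]) auto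
qed

lemma e_positive_scaleR:
  assumes "e_positive f" "r \<ge> 0"
  shows "e_positive (r *\<^sub>R f)"
proof -
  from assms obtain P c where P: "finite P" "\<forall>lam\<in>P. is_partition lam \<and> c lam \<ge> (0 :: real)"
    "f = (\<Sum>lam\<in>P. c lam *\<^sub>R elementary_partition lam)"
    unfolding e_positive_def by blast
  then have "r *\<^sub>R f = (\<Sum>lam\<in>P. (r * c lam) *\<^sub>R elementary_partition lam)"
    by (simp add: scaleR_sum_right)
  then show ?thesis
    unfolding e_positive_def using P assms(2)
    by (intro exI[of _ P] exI[of _ "\<lambda>lam. r * c lam"]) auto
qed

text \<open>Multiplying by \<open>e\<^sub>i\<close> adds the part \<open>i\<close> to each partition, which is an injective map on partitions.\<close>

lemma e_positive_elementary_mult: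
  assumes "e_positive f" "i > 0"
  shows "e_positive (elementary i * f)"
proof -
  from assms obtain P c where P: "finite P" "\<forall>lam\<in>P. is_partition lam \<and> c lam \<ge> (0 :: real)"
    "f = (\<Sum>lam\<in>P. c lam *\<^sub>R elementary_partition lam)"
    unfolding e_positive_def by blast
  have "elementary i * f = (\<Sum>lam\<in>P. c lam *\<^sub>R elementary_partition (add_mset i lam))"
    by (simp add: P(3) sum_distrib_left elementary_partition_def)
  also have "\<dots> = (\<Sum>lam\<in>add_mset i ` P. c (lam - {#i#}) *\<^sub>R elementary_partition lam)"
    by (subst sum.reindex) (auto simp: inj_on_def)
  finally show ?thesis
    unfolding e_positive_def using P(1,2) assms(2)
    by (intro exI[of _ "add_mset i ` P"] exI[of _ "\<lambda>lam. c (lam - {#i#})"])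
      (auto simp: is_partition_def)
qed

lemma e_positive_elementary:
  assumes "i > 0"
  shows "e_positive (elementary i)"
  using e_positive_elementary_partition[of "{#i#}"] assms
  by (simp add: elementary_partition_def is_partition_def)

lemma e_positive_one: "e_positive 1"
  using e_positive_elementary_partition[of "{#}"] by (simp add: elementary_partition_def is_partition_def)

section \<open>Expansion for a clique with two further vertices\<close>

lemma coeff_add: "coeff (f + g) m = coeff f m + coeff g m"
  by (simp add: plus_power_series.rep_eq)

lemma coeff_diff: "coeff (f - g) m = coeff f m - coeff g m"
  by (simp add: minus_power_series.rep_eq)

lemma coeff_scaleR: "coeff (r *\<^sub>R f) m = r * coeff f m"
  by (simp add: scaleR_power_series.rep_eq)

lemma two_mult_le_of_sum_le:
  fixes x y N :: real
  assumes "x \<ge> 0" "y \<ge> 0" "x + y \<le> N"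
  shows "4 * (x * y) \<le> N * (x + y)"
proof -
  have "4 * (x * y) \<le> (x + y) * (x + y)"
    using zero_le_square[of "x - y"] by (simp add: algebra_simps)
  also have "\<dots> \<le> N * (x + y)" using assms by (intro mult_right_mono) auto
  finally show ?thesis .
qed

text \<open>The relations of \<open>clique_plus_two_vertices\<close>, read at one coefficient and solved: \<open>N\<close> is the size of
the clique, \<open>f\<close> its factorial, and \<open>x1\<close>, \<open>x2\<close>, \<open>x3\<close>, \<open>x4\<close> stand for the coefficients of \<open>e\<^sub>N e\<^sub>1 e\<^sub>1\<close>, \<open>e\<^sub>N e\<^sub>2\<close>,
\<open>e\<^sub>N\<^sub>+\<^sub>1 e\<^sub>1\<close>, \<open>e\<^sub>N\<^sub>+\<^sub>2\<close>. The factor \<open>N (N - 1)\<close> avoids division; it kills all information when \<open>N = 1\<close>.\<close>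

lemma solve_match_equations:
  fixes N a b s f \<alpha> \<beta> \<gamma> \<delta> \<tau> X x1 x2 x3 x4 :: real
  assumes N: "N + 1 \<noteq> 0"
    and \<alpha>: "\<alpha> = f * x1" and \<tau>: "\<tau> = \<alpha> - 2 * f * x2"
    and \<beta>: "N * \<beta> = \<alpha> - (N + 1) * f * x3"
    and \<delta>: "(N + 1) * (\<tau> - N * \<delta>) = (N + 1) * f * x3 - (N + 2) * (N + 1) * f * x4"
    and \<gamma>: "\<beta> - (N - 1) * \<gamma> - \<delta> = \<tau> - N * \<delta>"
    and X: "X = \<alpha> - (a + b) * \<beta> + (a * b - s) * \<gamma> + s * \<delta>"
  shows "N * (N - 1) * X = f * ((N - 1) * (N - a - b + s) * x1 + 2 * (a * b - N * s) * x2 +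
    ((N * N - 1) * (a + b) - 2 * N * (a * b) + (N + 1) * s) * x3 + (N + 2) * (N - 1) * (a * b) * x4)"
proof -
  have \<delta>': "N * \<delta> = \<tau> - f * x3 + (N + 2) * f * x4"
  proof -
    have "(N + 1) * (\<tau> - N * \<delta>) = (N + 1) * (f * x3 - (N + 2) * f * x4)"
      unfolding \<delta> by (simp add: algebra_simps)
    then show ?thesis using N by (simp only: mult_cancel_left) auto
  qed
  have \<gamma>': "N * (N - 1) * \<gamma> = N * \<beta> - N * \<delta> - N * (\<tau> - N * \<delta>)"
  proof -
    have "(N - 1) * \<gamma> = \<beta> - \<delta> - (\<tau> - N * \<delta>)" using \<gamma> by simp
    then have "N * ((N - 1) * \<gamma>) = N * (\<beta> - \<delta> - (\<tau> - N * \<delta>))" by simp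
    then show ?thesis by (simp add: algebra_simps)
  qed
  have "N * (N - 1) * X = N * (N - 1) * \<alpha> - (N - 1) * (a + b) * (N * \<beta>) +
      (a * b - s) * (N * (N - 1) * \<gamma>) + (N - 1) * s * (N * \<delta>)"
    unfolding X by (simp add: algebra_simps)
  also have "\<dots> = f * ((N - 1) * (N - a - b + s) * x1 + 2 * (a * b - N * s) * x2 +
    ((N * N - 1) * (a + b) - 2 * N * (a * b) + (N + 1) * s) * x3 + (N + 2) * (N - 1) * (a * b) * x4)"
    unfolding \<gamma>' \<beta> \<delta>' \<tau> \<alpha> by (simp add: algebra_simps)
  finally show ?thesis .
qed

text \<open>The hypothesis on the shape of \<open>A\<close> and \<open>B\<close> leaves two values for the size of \<open>A \<inter> B\<close>, and for both the
coefficients of \<open>solve_match_equations\<close> are nonnegative.\<close>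

lemma clique_plus_two_e_positive:
  fixes K :: "'a set" and u w :: 'a
  assumes fin: "finite K" and uw: "u \<notin> K" "w \<notin> K" "u \<noteq> w"
    and AB: "A \<subseteq> K" "B \<subseteq> K" "A \<noteq> {}" "B \<noteq> {}" and shape: "A \<inter> B = {} \<or> A \<union> B = K"
  shows "e_positive (colour_sum (insert u (insert w K))
    (\<lambda>\<kappa>. inj_on \<kappa> K \<and> \<kappa> u \<notin> \<kappa> ` A \<and> \<kappa> w \<notin> \<kappa> ` B))" (is "e_positive ?X")
proof -
  define n where "n = card K"
  define a b s where "a = real (card A)" and "b = real (card B)" and "s = real (card (A \<inter> B))"
  have finA: "finite A" and finB: "finite B" using fin AB finite_subset by auto
  have "K \<noteq> {}" using AB by blast
  then have n0: "n > 0" using fin by (simp add: n_def card_gt_0_iff)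
  have a1: "a \<ge> 1" "b \<ge> 1"
    using AB finA finB by (simp_all add: a_def b_def Suc_le_eq card_gt_0_iff)
  have an: "a \<le> n" "b \<le> n"
    using AB fin by (simp_all add: a_def b_def n_def card_mono)
  have union: "a + b - s = real (card (A \<union> B))"
    using card_Un_Int[OF finA finB] by (simp add: a_def b_def s_def)
  also have "\<dots> \<le> n" using AB fin by (simp add: n_def card_mono)
  finally have abs: "a + b - s \<le> n" .
  have s0: "s \<ge> 0" by (simp add: s_def)
  have shape': "s = 0 \<or> s = a + b - n"
    using shape union by (auto simp: s_def n_def)
  obtain \<beta> \<gamma> \<delta> where rel:
    "real n *\<^sub>R \<beta> = fact n *\<^sub>R (elementary n * elementary 1 * elementary 1) -
       fact (n + 1) *\<^sub>R (elementary (n + 1) * elementary 1)"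
    "real (n + 1) *\<^sub>R (fact n *\<^sub>R (elementary n * elementary 1 * elementary 1) -
        (2 * fact n) *\<^sub>R (elementary n * elementary 2) - real n *\<^sub>R \<delta>) =
       fact (n + 1) *\<^sub>R (elementary (n + 1) * elementary 1) - fact (n + 2) *\<^sub>R elementary (n + 2)"
    "\<beta> - (real n - 1) *\<^sub>R \<gamma> - \<delta> = fact n *\<^sub>R (elementary n * elementary 1 * elementary 1) -
        (2 * fact n) *\<^sub>R (elementary n * elementary 2) - real n *\<^sub>R \<delta>"
    "?X = fact n *\<^sub>R (elementary n * elementary 1 * elementary 1) -
       (a + b) *\<^sub>R \<beta> + (a * b - s) *\<^sub>R \<gamma> + s *\<^sub>R \<delta>"
    using clique_plus_two_vertices[OF fin uw \<open>K \<noteq> {}\<close> AB(1,2)]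
    unfolding n_def a_def b_def s_def of_nat_add by blast
  let ?e1 = "elementary n * elementary 1 * elementary 1" and ?e2 = "elementary n * elementary 2"
    and ?e3 = "elementary (n + 1) * elementary 1" and ?e4 = "elementary (n + 2)"
  have pos: "e_positive ?e1" "e_positive ?e2" "e_positive ?e3" "e_positive ?e4"
    using n0 by (simp_all add: e_positive_elementary_mult e_positive_elementary mult.assoc)
  note rel_coeff = rel[THEN arg_cong, of "\<lambda>f. coeff f _", unfolded coeff_add coeff_diff coeff_scaleR]
  show ?thesis
  proof (cases "n = 1")
    case True
    \<comment> \<open>The graph is the path \<open>u\<close>, \<open>k\<close>, \<open>w\<close>, where \<open>k\<close> is the only element of \<open>K\<close>.\<close>
    then have ab: "a = 1" "b = 1" "s = 1"
      using a1 an abs shape' by auto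
    have "?X = 1 *\<^sub>R ?e3 + 3 *\<^sub>R ?e4"
    proof (rule power_series_eqI)
      fix m
      show "coeff ?X m = coeff (1 *\<^sub>R ?e3 + 3 *\<^sub>R ?e4) m"
        using rel_coeff[of m] by (simp add: True ab coeff_add coeff_scaleR fact_numeral)
    qed
    then show ?thesis
      using pos by (simp add: e_positive_add e_positive_scaleR del: scaleR_one)
  next
    case False
    define N where "N = real n"
    have N: "N \<ge> 2" using False n0 by (simp add: N_def)
    define c1 c2 c3 c4 where "c1 = (N - 1) * (N - a - b + s)" and "c2 = 2 * (a * b - N * s)"
      and "c3 = (N * N - 1) * (a + b) - 2 * N * (a * b) + (N + 1) * s"
      and "c4 = (N + 2) * (N - 1) * (a * b)"
    define d where "d = fact n / (N * (N - 1))"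
    have "?X = (d * c1) *\<^sub>R ?e1 + (d * c2) *\<^sub>R ?e2 + (d * c3) *\<^sub>R ?e3 + (d * c4) *\<^sub>R ?e4"
    proof (rule power_series_eqI)
      fix m
      have "N * (N - 1) * coeff ?X m =
          fact n * (c1 * coeff ?e1 m + c2 * coeff ?e2 m + c3 * coeff ?e3 m + c4 * coeff ?e4 m)"
        unfolding c1_def c2_def c3_def c4_def
        using N rel_coeff[of m]
        by (intro solve_match_equations[where \<alpha> = "fact n * coeff ?e1 m" and \<beta> = "coeff \<beta> m"
              and \<gamma> = "coeff \<gamma> m" and \<delta> = "coeff \<delta> m"
              and \<tau> = "fact n * coeff ?e1 m - 2 * fact n * coeff ?e2 m"])
          (simp_all add: N_def algebra_simps)
      then have "coeff ?X m = d * (c1 * coeff ?e1 m + c2 * coeff ?e2 m + c3 * coeff ?e3 m + c4 * coeff ?e4 m)"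
        using N by (simp add: d_def field_simps)
      then show "coeff ?X m = coeff ((d * c1) *\<^sub>R ?e1 + (d * c2) *\<^sub>R ?e2 + (d * c3) *\<^sub>R ?e3 + (d * c4) *\<^sub>R ?e4) m"
        by (simp add: coeff_add coeff_scaleR algebra_simps)
    qed
    moreover have "d \<ge> 0" using N by (simp add: d_def)
    moreover have "c1 \<ge> 0" using N abs by (simp add: c1_def N_def)
    moreover have "c4 \<ge> 0" using N a1 by (simp add: c4_def)
    moreover have "c2 \<ge> 0 \<and> c3 \<ge> 0"
      using shape'
    proof
      assume s: "s = 0"
      have "2 * N * (a * b) \<le> N * N / 2 * (a + b)"
        using mult_left_mono[OF two_mult_le_of_sum_le[of a b N], of "N / 2"] a1 abs s N
        by (simp add: N_def)
      also have "\<dots> \<le> (N * N - 1) * (a + b)"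
        using a1 N mult_mono[of 2 N 2 N] by (intro mult_right_mono) auto
      finally show ?thesis using s a1 by (simp add: c2_def c3_def)
    next
      assume s: "s = a + b - n"
      \<comment> \<open>The numbers of non-neighbours of \<open>u\<close> and \<open>w\<close> in \<open>K\<close>, for which \<open>p + q \<le> N\<close> replaces \<open>a + b \<le> N\<close>.\<close>
      define p q where "p = N - a" and "q = N - b"
      have pq: "p \<ge> 0" "q \<ge> 0" "p + q \<le> N"
        using an s s0 by (auto simp: p_def q_def N_def)
      have s': "s = N - p - q" "a = N - p" "b = N - q" using s by (auto simp: p_def q_def N_def)
      have "2 * (p * q) \<le> N / 2 * (p + q)"
        using two_mult_le_of_sum_le[OF pq] by simp
      also have "\<dots> \<le> (N - 1) * (p + q)" using N pq by (intro mult_right_mono) auto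
      also have "\<dots> \<le> (N - 1) * (p + q + 1)" using N by (intro mult_left_mono) auto
      finally have "0 \<le> N * ((N - 1) * (p + q + 1) - 2 * (p * q))" using N by simp
      also have "\<dots> = c3" unfolding c3_def s' by (simp add: algebra_simps)
      finally have "c3 \<ge> 0" .
      moreover have "c2 = 2 * (p * q)" unfolding c2_def s' by (simp add: algebra_simps)
      ultimately show ?thesis using pq by simp
    qed
    ultimately show ?thesis
      using pos by (simp add: e_positive_add e_positive_scaleR)
  qed
qed

section \<open>Structure of 2K2-free unit interval graphs\<close>

lemma induced_twoK2:
  assumes G: "simple_graph V E" and V: "{p, q, r, s} \<subseteq> V"
    and e: "{p, q} \<in> E" "{r, s} \<in> E"
    and ne: "{p, r} \<notin> E" "{p, s} \<notin> E" "{q, r} \<notin> E" "{q, s} \<notin> E"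
  shows "\<not> twoK2_free V E"
proof -
  have sing: "{x} \<notin> E" for x using G by (auto simp: simple_graph_def)
  have "p \<noteq> q" "r \<noteq> s" using e sing by auto
  moreover have "p \<noteq> r" "p \<noteq> s" "q \<noteq> r" "q \<noteq> s" using e ne by (auto simp: insert_commute)
  ultimately have d: "distinct [p, q, r, s]" by auto
  define \<phi> :: "'a \<Rightarrow> nat" where "\<phi> = (\<lambda>x. if x = p then 0 else if x = q then 1 else if x = r then 2 else 3)"
  have \<phi>: "\<phi> p = 0" "\<phi> q = 1" "\<phi> r = 2" "\<phi> s = 3" using d by (auto simp: \<phi>_def)
  let ?W = "{p, q, r, s}"
  have "bij_betw \<phi> ?W twoK2_verts"
    by (auto simp: bij_betw_def inj_on_def \<phi> twoK2_verts_def)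
  moreover have "{x, y} \<in> induced_edges E ?W \<longleftrightarrow> {\<phi> x, \<phi> y} \<in> twoK2_edges"
    if "x \<in> ?W" "y \<in> ?W" for x y
    using that e ne sing d
    by (auto simp: induced_edges_def twoK2_edges_def \<phi> doubleton_eq_iff insert_commute)
  ultimately show ?thesis
    using V unfolding twoK2_free_def graph_isomorphic_def by blast
qed

text \<open>Two closed unit intervals meet exactly if their left ends are at distance at most one.\<close>

definition unit_interval_representation :: "'a set \<Rightarrow> 'a set set \<Rightarrow> ('a \<Rightarrow> real) \<Rightarrow> bool" where
  "unit_interval_representation V E l \<longleftrightarrow>
     (\<forall>u\<in>V. \<forall>v\<in>V. u \<noteq> v \<longrightarrow> ({u, v} \<in> E \<longleftrightarrow> \<bar>l u - l v\<bar> \<le> 1))"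

lemma unit_interval_graph_alt:
  "unit_interval_graph V E \<longleftrightarrow> simple_graph V E \<and> (\<exists>l. unit_interval_representation V E l)"
proof -
  have "{x..x + 1} \<inter> {y..y + 1} \<noteq> {} \<longleftrightarrow> \<bar>x - y\<bar> \<le> 1" for x y :: real
    by (auto simp: Int_atLeastAtMost)
  then show ?thesis
    by (simp only: unit_interval_graph_def unit_interval_representation_def)
qed

text \<open>For \<open>x\<close> to the left of \<open>y\<close> and not adjacent to it, the vertex \<open>u\<close> has a neighbour \<open>p\<close> that does not lie to the
right of \<open>x\<close>: either \<open>x\<close> itself, or any neighbour \<open>u'\<close> of \<open>u\<close>, since \<open>x\<close> is then too far right to be
adjacent to \<open>u\<close>. Likewise \<open>w\<close> has a neighbour \<open>q\<close> that does not lie to the left of \<open>y\<close>. The gap between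
\<open>x\<close> and \<open>y\<close> separates the two edges.\<close>

lemma middle_is_clique:
  assumes G: "simple_graph V E" and rep: "unit_interval_representation V E l"
    and free: "twoK2_free V E"
    and u: "u \<in> V" "\<And>v. v \<in> V \<Longrightarrow> l u \<le> l v" and w: "w \<in> V" "\<And>v. v \<in> V \<Longrightarrow> l v \<le> l w"
    and uw: "l w > l u + 1"
    and nb: "u' \<in> V" "{u, u'} \<in> E" "w' \<in> V" "{w, w'} \<in> E"
    and xy: "x \<in> V - {u, w}" "y \<in> V - {u, w}" "x \<noteq> y"
  shows "{x, y} \<in> E"
proof -
  have sing: "{x} \<notin> E" for x using G by (auto simp: simple_graph_def)
  have far: "{a, b} \<notin> E" if "a \<in> V" "b \<in> V" "l a + 1 < l b" for a b
    using rep that by (force simp: unit_interval_representation_def)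
  have near: "\<bar>l a - l b\<bar> \<le> 1" if "a \<in> V" "b \<in> V" "{a, b} \<in> E" for a b
    using rep that sing by (cases "a = b") (auto simp: unit_interval_representation_def)
  have *: "l y \<le> l x + 1" if x: "x \<in> V - {u, w}" and y: "y \<in> V - {u, w}" for x y
  proof (rule ccontr)
    assume xy: "\<not> l y \<le> l x + 1"
    obtain p where p: "p \<in> V" "{u, p} \<in> E" "l p \<le> l x"
    proof (cases "{u, x} \<in> E")
      case True
      then show thesis using x that[of x] by simp
    next
      case False
      then have "l x > l u + 1"
        using rep x u by (force simp: unit_interval_representation_def)
      moreover have "l u' \<le> l u + 1" using near[of u u'] u nb by auto
      ultimately show thesis using nb that[of u'] by simp
    qed
    obtain q where q: "q \<in> V" "{w, q} \<in> E" "l q \<ge> l y"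
    proof (cases "{w, y} \<in> E")
      case True
      then show thesis using y that[of y] by simp
    next
      case False
      then have "l y < l w - 1"
        using rep y w by (force simp: unit_interval_representation_def)
      moreover have "l w' \<ge> l w - 1" using near[of w w'] w nb by auto
      ultimately show thesis using nb that[of w'] by simp
    qed
    have "\<not> twoK2_free V E"
    proof (rule induced_twoK2[OF G, of u p w q])
      show "{u, p, w, q} \<subseteq> V" using u w p q by simp
      show "{u, p} \<in> E" "{w, q} \<in> E" by fact+
      have "l u \<le> l x" "l y \<le> l w" using u w x y by auto
      then show "{u, w} \<notin> E" "{u, q} \<notin> E" "{p, w} \<notin> E" "{p, q} \<notin> E"
        using far[of u w] far[of u q] far[of p w] far[of p q] u(1) w(1) p q xy by auto
    qed
    then show False using free by simp
  qed
  have "\<bar>l x - l y\<bar> \<le> 1" using *[OF xy(1,2)] *[OF xy(2,1)] by linarith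
  then show ?thesis using rep xy by (auto simp: unit_interval_representation_def)
qed

lemma chromatic_isolated_vertex:
  assumes G: "simple_graph V E" and v: "v \<in> V" and iso: "\<And>e. e \<in> E \<Longrightarrow> v \<notin> e"
  shows "chromatic_symmetric_function V E = elementary 1 * chromatic_symmetric_function (V - {v}) E"
proof -
  have finV: "finite V" using G by (simp add: simple_graph_def)
  let ?P = "\<lambda>\<kappa> :: 'a \<Rightarrow> nat. \<forall>x\<in>V - {v}. \<forall>y\<in>V - {v}. {x, y} \<in> E \<longrightarrow> \<kappa> x \<noteq> \<kappa> y"
  have V: "V = {v} \<union> (V - {v})" using v by blast
  have "chromatic_symmetric_function V E = colour_sum ({v} \<union> (V - {v}))
      (\<lambda>\<kappa>. inj_on (restrict \<kappa> {v}) {v} \<and> ?P (restrict \<kappa> (V - {v})))"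
    unfolding chromatic_as_colour_sum V[symmetric] using iso by (intro colour_sum_cong) auto
  also have "\<dots> = colour_sum {v} (\<lambda>\<kappa>. inj_on \<kappa> {v}) * colour_sum (V - {v}) ?P"
    using finV by (intro colour_sum_disjoint_union) auto
  finally show ?thesis
    by (simp add: colour_sum_clique chromatic_as_colour_sum del: inj_on_insert)
qed

section \<open>e-positivity\<close>

theorem theorem3p6:
  fixes V :: "'a set" and E :: "'a set set"
  assumes "unit_interval_graph V E"
    and "twoK2_free V E"
  shows "e_positive (chromatic_symmetric_function V E)"
proof -
  have "finite V" using assms(1) by (simp add: unit_interval_graph_def simple_graph_def)
  then show ?thesis using assms
  proof (induction V arbitrary: E rule: finite_psubset_induct)
    case (psubset V E)
    obtain l where G: "simple_graph V E" and rep: "unit_interval_representation V E l"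
      using psubset.prems(1) by (auto simp: unit_interval_graph_alt)
    note free = psubset.prems(2) and finV = psubset.hyps
    have sing: "{x} \<notin> E" for x using G by (auto simp: simple_graph_def)
    consider (empty) "V = {}" | (isolated) v where "v \<in> V" "\<And>e. e \<in> E \<Longrightarrow> v \<notin> e"
      | (covered) "V \<noteq> {}" "\<And>v. v \<in> V \<Longrightarrow> \<exists>e\<in>E. v \<in> e" by blast
    then show ?case
    proof cases
      case empty
      have "coeff (chromatic_symmetric_function {} E) m = coeff 1 m" for m
        by (auto simp: chromatic_as_colour_sum coeff_colour_sum colouring_weight_def one_power_series.rep_eq)
      then show ?thesis
        using e_positive_one empty power_series_eqI by metis
    next
      case isolated
      have "simple_graph (V - {v}) E"
        using G isolated(2) by (auto simp: simple_graph_def)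
      moreover have "unit_interval_representation (V - {v}) E l"
        using rep by (simp add: unit_interval_representation_def)
      moreover have "twoK2_free (V - {v}) E"
        using free by (auto simp: twoK2_free_def)
      ultimately have "e_positive (chromatic_symmetric_function (V - {v}) E)"
        using isolated(1) by (intro psubset.IH) (auto simp: unit_interval_graph_alt)
      then show ?thesis
        by (simp add: chromatic_isolated_vertex[OF G isolated] e_positive_elementary_mult)
    next
      case covered
      have neighbour: "\<exists>v'\<in>V. {v, v'} \<in> E" if "v \<in> V" for v
      proof -
        from covered(2)[OF that] obtain e where e: "e \<in> E" "v \<in> e" by blast
        then have "card e = 2" "e \<subseteq> V" using G by (auto simp: simple_graph_def)
        then obtain x y where "e = {x, y}" by (auto simp: card_2_iff)
        then show ?thesis using e \<open>e \<subseteq> V\<close> by (auto simp: insert_commute)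
      qed
      obtain u where u: "u \<in> V" "\<And>v. v \<in> V \<Longrightarrow> l u \<le> l v"
      proof -
        have "Min (l ` V) \<in> l ` V" using finV covered(1) by simp
        then obtain u where "u \<in> V" "l u = Min (l ` V)" by auto
        then show thesis using finV that[of u] by simp
      qed
      obtain w where w: "w \<in> V" "\<And>v. v \<in> V \<Longrightarrow> l v \<le> l w"
      proof -
        have "Max (l ` V) \<in> l ` V" using finV covered(1) by simp
        then obtain w where "w \<in> V" "l w = Max (l ` V)" by auto
        then show thesis using finV that[of w] by simp
      qed
      show ?thesis
      proof (cases "l w \<le> l u + 1")
        case True
        have "{x, y} \<in> E \<longleftrightarrow> x \<noteq> y" if "x \<in> V" "y \<in> V" for x y
          using u(2)[OF that(1)] u(2)[OF that(2)] w(2)[OF that(1)] w(2)[OF that(2)] True rep that sing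
          by (cases "x = y") (auto simp: unit_interval_representation_def)
        then have "chromatic_symmetric_function V E = colour_sum V (\<lambda>\<kappa>. inj_on \<kappa> V)"
          unfolding chromatic_as_colour_sum by (intro colour_sum_cong) (auto simp: inj_on_def)
        moreover have "card V > 0" using finV covered(1) by (simp add: card_gt_0_iff)
        ultimately show ?thesis
          by (simp add: colour_sum_clique finV e_positive_scaleR e_positive_elementary)
      next
        case False
        then have far: "l w > l u + 1" by simp
        then have "u \<noteq> w" by auto
        define K where "K = V - {u, w}"
        define A where "A = {k \<in> K. {u, k} \<in> E}"
        define B where "B = {k \<in> K. {w, k} \<in> E}"
        have V: "V = insert u (insert w K)" using u w by (auto simp: K_def)
        obtain u' where u': "u' \<in> V" "{u, u'} \<in> E" using neighbour[OF u(1)] by blast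
        obtain w' where w': "w' \<in> V" "{w, w'} \<in> E" using neighbour[OF w(1)] by blast
        have uw: "{u, w} \<notin> E" using rep u(1) w(1) far \<open>u \<noteq> w\<close>
          by (auto simp: unit_interval_representation_def)
        have "u' \<in> A" "w' \<in> B"
          using u' w' uw sing by (auto simp: A_def B_def K_def insert_commute)
        have clique: "{x, y} \<in> E \<longleftrightarrow> x \<noteq> y" if "x \<in> K" "y \<in> K" for x y
          using middle_is_clique[OF G rep free u w far u' w', of x y] that sing
          by (cases "x = y") (auto simp: K_def)
        have adj: "{v, k} \<in> E \<longleftrightarrow> \<bar>l v - l k\<bar> \<le> 1" if "k \<in> K" "v \<in> {u, w}" for v k
          using rep that u(1) w(1) by (auto simp: K_def unit_interval_representation_def)
        \<comment> \<open>A vertex adjacent to neither \<open>u\<close> nor \<open>w\<close> forces their left ends more than 2 apart, a common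
          neighbour forces them at most 2 apart.\<close>
        have "A \<inter> B = {} \<or> A \<union> B = K"
        proof (rule disjCI)
          assume "A \<union> B \<noteq> K"
          then obtain k where k: "k \<in> K" "k \<notin> A" "k \<notin> B" by (auto simp: A_def B_def)
          have lk: "l u \<le> l k" "l k \<le> l w" using u w k by (auto simp: K_def)
          show "A \<inter> B = {}"
          proof (rule equals0I)
            fix x assume x: "x \<in> A \<inter> B"
            then have "\<bar>l u - l x\<bar> \<le> 1" "\<bar>l w - l x\<bar> \<le> 1"
              using adj by (auto simp: A_def B_def)
            moreover have "\<not> \<bar>l u - l k\<bar> \<le> 1" "\<not> \<bar>l w - l k\<bar> \<le> 1"
              using adj[of k] k by (auto simp: A_def B_def)
            ultimately show False using lk by linarith
          qed
        qed
        then have "e_positive (colour_sum (insert u (insert w K))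
            (\<lambda>\<kappa>. inj_on \<kappa> K \<and> \<kappa> u \<notin> \<kappa> ` A \<and> \<kappa> w \<notin> \<kappa> ` B))"
          using finV \<open>u \<noteq> w\<close> \<open>u' \<in> A\<close> \<open>w' \<in> B\<close>
          by (intro clique_plus_two_e_positive) (auto simp: K_def A_def B_def)
        moreover have "chromatic_symmetric_function V E = colour_sum (insert u (insert w K))
            (\<lambda>\<kappa>. inj_on \<kappa> K \<and> \<kappa> u \<notin> \<kappa> ` A \<and> \<kappa> w \<notin> \<kappa> ` B)"
          unfolding chromatic_as_colour_sum V
        proof (rule colour_sum_cong)
          fix \<kappa> :: "'a \<Rightarrow> nat"
          show "(\<forall>x\<in>insert u (insert w K). \<forall>y\<in>insert u (insert w K). {x, y} \<in> E \<longrightarrow> \<kappa> x \<noteq> \<kappa> y) \<longleftrightarrow>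
              inj_on \<kappa> K \<and> \<kappa> u \<notin> \<kappa> ` A \<and> \<kappa> w \<notin> \<kappa> ` B"
          proof (intro iffI)
            assume proper: "\<forall>x\<in>insert u (insert w K). \<forall>y\<in>insert u (insert w K). {x, y} \<in> E \<longrightarrow> \<kappa> x \<noteq> \<kappa> y"
            have "inj_on \<kappa> K"
              using proper clique by (intro inj_onI) (metis insertCI)
            then show "inj_on \<kappa> K \<and> \<kappa> u \<notin> \<kappa> ` A \<and> \<kappa> w \<notin> \<kappa> ` B"
              using proper by (auto simp: A_def B_def)
          next
            assume proper: "inj_on \<kappa> K \<and> \<kappa> u \<notin> \<kappa> ` A \<and> \<kappa> w \<notin> \<kappa> ` B"
            have ku: "\<kappa> u \<noteq> \<kappa> k" if "k \<in> K" "{u, k} \<in> E" for k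
              using proper that by (auto simp: A_def)
            have kw: "\<kappa> w \<noteq> \<kappa> k" if "k \<in> K" "{w, k} \<in> E" for k
              using proper that by (auto simp: B_def)
            have kk: "\<kappa> j \<noteq> \<kappa> k" if "j \<in> K" "k \<in> K" "{j, k} \<in> E" for j k
              using proper that clique by (auto dest: inj_onD)
            show "\<forall>x\<in>insert u (insert w K). \<forall>y\<in>insert u (insert w K). {x, y} \<in> E \<longrightarrow> \<kappa> x \<noteq> \<kappa> y"
            proof (intro ballI impI)
              fix x y assume "x \<in> insert u (insert w K)" "y \<in> insert u (insert w K)" "{x, y} \<in> E"
              then consider "x \<in> K" "y \<in> K" | "x = u" "y \<in> K" | "x = w" "y \<in> K"
                | "y = u" "x \<in> K" | "y = w" "x \<in> K"
                using uw sing by (auto simp: insert_commute)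
              then show "\<kappa> x \<noteq> \<kappa> y"
                using \<open>{x, y} \<in> E\<close> ku[of y] kw[of y] ku[of x] kw[of x] kk[of x y]
                by cases (auto simp: insert_commute)
            qed
          qed
        qed
        ultimately show ?thesis by simp
      qed
    qed
  qed
qed

end
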